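(* Let $\alpha,\beta,\gamma>0$ and $U=L^2(D;\mathbb{R}^2)$. Consider the system for $(y_\gamma,p_\gamma)\in Y\times V$ $$y_\gamma=SH_\gamma(p_\gamma),\qquad p_\gamma=-S^*(y_\gamma-z),$$ and the semismooth Newton iteration: given $(y^k,p^k)\in Y\times V$, compute $(\delta y,\delta p)\in Y\times V$ such that $$\delta y-S\,D_NH_\gamma(p^k)\,\delta p=-y^k+SH_\gamma(p^k),\qquad \delta p+S^*\delta y=-p^k-S^*(y^k-z),$$ and set $y^{k+1}=y^k+\delta y$, $p^{k+1}=p^k+\delta p$. This iteration converges locally superlinearly in $Y\times V$; that is, for a solution $(y_\gamma,p_\gamma)\in Y\times V$ of the system there is a neighborhood of $(y_\gamma,p_\gamma)$ in $Y\times V$ such that for every starting point $(y^0,p^0)$ in it, the iterates converge to $(y_\gamma,p_\gamma)$ in $Y\times V$ and $$\|(y^{k+1},p^{k+1})-(y_\gamma,p_\gamma)\|_{Y\times V}=o\left(\|(y^k,p^k)-(y_\gamma,p_\gamma)\|_{Y\times V}\right)\quad\text{as }k\to\infty.$$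
   Context: $D\subset\mathbb{R}^d$ ($d\ge1$) is a measurable set of finite Lebesgue measure. $Y$ is a real Hilbert space identified with its dual, $z\in Y$ is given, and $S:U\to Y$ is a bounded linear operator with adjoint $S^*:Y\to U$ (with $U$ identified with its dual); $V$ is a Banach space continuously embedded in $L^r(D;\mathbb{R}^2)$ for some $r>2$ such that $S^*$ maps $Y$ continuously into $V$. Let $g:\mathbb{R}^2\to\mathbb{R}$, $g(v)=\frac\alpha2(v_1^2+v_2^2)+\beta|v_1v_2|_0$, where $|t|_0=1$ if $t\ne0$ and $|0|_0=0$; let $g^*(q)=\sup_{v\in\mathbb{R}^2}v\cdot q-g(v)$ be its Fenchel conjugate, and let $h_\gamma:\mathbb{R}^2\to\mathbb{R}^2$ be the Moreau–Yosida regularization of $\partial g^*$, $$h_\gamma(q)=\frac1\gamma\left(q-\mathrm{prox}_{\gamma g^*}(q)\right),\qquad \mathrm{prox}_{\gamma g^*}(q)=\arg\min_{w\in\mathbb{R}^2}g^*(w)+\frac1{2\gamma}|w-q|^2 .$$ The superposition operator is $[H_\gamma(p)](x)=h_\gamma(p(x))$. Its Newton derivative $D_NH_\gamma(p):V\to U$ is given pointwise almost everywhere by a measurable selection $[D_NH_\gamma(p)\delta p](x)\in\partial_Ch_\gamma(p(x))\,\delta p(x)$, i.e. $[D_NH_\gamma(p)\delta p](x)=M_p(x)\delta p(x)$ with $M_p:D\to\mathbb{R}^{2\times2}$ measurable (depending on $p$ but not on $\delta p$) and $M_p(x)\in\partial_Ch_\gamma(p(x))$ for a.e. $x\in D$,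 where $\partial_Ch_\gamma(q)$ is the Clarke generalized Jacobian of the (Lipschitz, piecewise differentiable) function $h_\gamma$ at $q$. *)

theory Defs
  imports "HOL-Analysis.Analysis" "HOL-Library.Landau_Symbols"
begin

text \<open>
  Lebesgue spaces are handled through representatives: an element of
  \<open>L\<^sup>p(\<mu>)\<close> is given by a measurable function, two of them being the same
  element iff they agree almost everywhere.
\<close>

definition Lp_fun :: "real \<Rightarrow> 'a measure \<Rightarrow> ('a \<Rightarrow> 'b::euclidean_space) set" where
  "Lp_fun p \<mu> = {f \<in> borel_measurable \<mu>. integrable \<mu> (\<lambda>x. norm (f x) powr p)}"

definition Lp_norm :: "real \<Rightarrow> 'a measure \<Rightarrow> ('a \<Rightarrow> 'b::euclidean_space) \<Rightarrow> real" where
  "Lp_norm p \<mu> f = (\<integral>x. norm (f x) powr p \<partial>\<mu>) powr (1 / p)"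

text \<open>
  Bounded linear operators on \<open>L\<^sup>2(\<mu>)\<close>. Linearity and the bound make the value
  independent of the representative, so this is the same as a bounded linear operator
  on the space of equivalence classes.
\<close>

definition bounded_linear_L2 ::
  "'a measure \<Rightarrow> (('a \<Rightarrow> 'b::euclidean_space) \<Rightarrow> 'y::real_normed_vector) \<Rightarrow> bool" where
  "bounded_linear_L2 \<mu> S \<longleftrightarrow>
     (\<forall>u\<in>Lp_fun 2 \<mu>. \<forall>v\<in>Lp_fun 2 \<mu>. S (\<lambda>x. u x + v x) = S u + S v) \<and>
     (\<forall>c. \<forall>u\<in>Lp_fun 2 \<mu>. S (\<lambda>x. c *\<^sub>R u x) = c *\<^sub>R S u) \<and>
     (\<exists>K. \<forall>u\<in>Lp_fun 2 \<mu>. norm (S u) \<le> K * Lp_norm 2 \<mu> u)"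

lemma bounded_linear_L2_cong_AE:
  fixes S :: "('a \<Rightarrow> 'b::euclidean_space) \<Rightarrow> 'y::real_normed_vector"
  assumes S: "bounded_linear_L2 \<mu> S"
    and u: "u \<in> Lp_fun 2 \<mu>" and v: "v \<in> Lp_fun 2 \<mu>"
    and eq: "AE x in \<mu>. u x = v x"
  shows "S u = S v"
proof -
  let ?n = "\<lambda>x. (-1::real) *\<^sub>R v x" and ?w = "\<lambda>x. u x + (-1) *\<^sub>R v x"
  have n: "?n \<in> Lp_fun 2 \<mu>"
    using v by (simp add: Lp_fun_def)
  have z: "AE x in \<mu>. norm (?w x) powr 2 = 0"
    using eq by eventually_elim simp
  have wm: "?w \<in> borel_measurable \<mu>"
    using u v by (intro borel_measurable_add borel_measurable_scaleR) (simp_all add: Lp_fun_def)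
  have wi: "integrable \<mu> (\<lambda>x. norm (?w x) powr 2)"
    using wm z by (subst integrable_cong_AE[where g = "\<lambda>x. 0"]) simp_all
  have w0: "Lp_norm 2 \<mu> ?w = 0"
    using z by (simp add: Lp_norm_def integral_eq_zero_AE)
  have "norm (S ?w) \<le> 0"
    using S wm wi w0 by (force simp: bounded_linear_L2_def Lp_fun_def)
  moreover have "S ?w = S u + S ?n"
    using S u n by (simp only: bounded_linear_L2_def)
  moreover have "S ?n = (-1) *\<^sub>R S v"
    using S v by (simp only: bounded_linear_L2_def)
  ultimately show ?thesis by simp
qed

text \<open>\<open>A\<close> represents the Hilbert space adjoint of \<open>S\<close>, with \<open>L\<^sup>2(\<mu>)\<close> identified with its dual.\<close>

definition is_adjoint_L2 ::
  "'a measure \<Rightarrow> (('a \<Rightarrow> 'b::euclidean_space) \<Rightarrow> 'y::real_inner) \<Rightarrow> ('y \<Rightarrow> 'a \<Rightarrow> 'b) \<Rightarrow> bool" where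
  "is_adjoint_L2 \<mu> S A \<longleftrightarrow>
     (\<forall>y. A y \<in> Lp_fun 2 \<mu>) \<and>
     (\<forall>y. \<forall>u\<in>Lp_fun 2 \<mu>. inner (S u) y = (\<integral>x. inner (u x) (A y x) \<partial>\<mu>))"

text \<open>
  A continuous embedding of a normed space into \<open>L\<^sup>r(\<mu>)\<close>: \<open>j v\<close> is a representative
  of the class of \<open>v\<close>, hence linearity and injectivity only hold up to null sets.
\<close>

definition Lp_embedding ::
  "real \<Rightarrow> 'a measure \<Rightarrow> ('v::real_normed_vector \<Rightarrow> 'a \<Rightarrow> 'b::euclidean_space) \<Rightarrow> bool" where
  "Lp_embedding r \<mu> j \<longleftrightarrow>
     (\<forall>v. j v \<in> Lp_fun r \<mu>) \<and>
     (\<forall>v w. AE x in \<mu>. j (v + w) x = j v x + j w x) \<and>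
     (\<forall>c v. AE x in \<mu>. j (c *\<^sub>R v) x = c *\<^sub>R j v x) \<and>
     (\<forall>v. (AE x in \<mu>. j v x = 0) \<longrightarrow> v = 0) \<and>
     (\<exists>K. \<forall>v. Lp_norm r \<mu> (j v) \<le> K * norm v)"

definition abs0 :: "real \<Rightarrow> real" where
  "abs0 t = (if t = 0 then 0 else 1)"

definition switching_cost :: "real \<Rightarrow> real \<Rightarrow> real^2 \<Rightarrow> real" where
  "switching_cost \<alpha> \<beta> v = \<alpha> / 2 * ((v $ 1)\<^sup>2 + (v $ 2)\<^sup>2) + \<beta> * abs0 (v $ 1 * v $ 2)"

text \<open>
  The supremum is taken in the reals, so it is meaningful only if it is finite; for
  \<^const>\<open>switching_cost\<close> this is the lemma \<open>bdd_above_switching_cost\<close> below.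
\<close>

definition fenchel_conjugate :: "('a::euclidean_space \<Rightarrow> real) \<Rightarrow> 'a \<Rightarrow> real" where
  "fenchel_conjugate f q = (SUP v. inner v q - f v)"

lemma bdd_above_switching_cost:
  assumes "\<alpha> > 0" "\<beta> \<ge> 0"
  shows "bdd_above (range (\<lambda>v. inner v q - switching_cost \<alpha> \<beta> v))"
proof (rule bdd_aboveI2)
  fix v :: "real^2"
  have 1: "a * b \<le> \<alpha> / 2 * a\<^sup>2 + b\<^sup>2 / (2 * \<alpha>)" for a b :: real
  proof -
    have "0 \<le> (\<alpha> * a - b)\<^sup>2 / (2 * \<alpha>)" using assms by simp
    also have "\<dots> = \<alpha> / 2 * a\<^sup>2 + b\<^sup>2 / (2 * \<alpha>) - a * b"
      using assms by (simp add: field_simps power2_eq_square)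
    finally show ?thesis by simp
  qed
  have 2: "0 \<le> \<beta> * abs0 (v $ 1 * v $ 2)"
    using assms by (simp add: abs0_def)
  show "inner v q - switching_cost \<alpha> \<beta> v \<le> (q $ 1)\<^sup>2 / (2 * \<alpha>) + (q $ 2)\<^sup>2 / (2 * \<alpha>)"
    using 1[of "v $ 1" "q $ 1"] 1[of "v $ 2" "q $ 2"] 2
    by (simp add: switching_cost_def inner_vec_def UNIV_2 algebra_simps)
qed

text \<open>
  \<^const>\<open>arg_min\<close> picks some minimizer; for convex \<open>f\<close> and \<open>\<gamma> > 0\<close> the objective is
  strongly convex, so there is exactly one.
\<close>

definition prox :: "real \<Rightarrow> ('a::euclidean_space \<Rightarrow> real) \<Rightarrow> 'a \<Rightarrow> 'a" where
  "prox \<gamma> f q = (ARG_MIN (\<lambda>w. f w + 1 / (2 * \<gamma>) * (norm (w - q))\<^sup>2) w. True)"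

definition h_reg :: "real \<Rightarrow> real \<Rightarrow> real \<Rightarrow> real^2 \<Rightarrow> real^2" where
  "h_reg \<alpha> \<beta> \<gamma> q = (1 / \<gamma>) *\<^sub>R (q - prox \<gamma> (fenchel_conjugate (switching_cost \<alpha> \<beta>)) q)"

definition clarke_jacobian :: "(real^'n \<Rightarrow> real^'m) \<Rightarrow> real^'n \<Rightarrow> (real^'n^'m) set" where
  "clarke_jacobian f q = convex hull
     {M. \<exists>s. (\<forall>n. f differentiable (at (s n))) \<and> s \<longlonglongrightarrow> q \<and>
             (\<lambda>n::nat. jacobian f (at (s n))) \<longlonglongrightarrow> M}"

text \<open>
  A choice of Newton derivatives of the superposition operator induced by \<open>h\<close>: for every
  \<open>p\<close> a measurable matrix field \<open>M p\<close>, acting by \<open>\<delta>p \<mapsto> (x \<mapsto> M p x *v j \<delta>p x)\<close>.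
\<close>

definition newton_selection ::
  "'a measure \<Rightarrow> (real^'n \<Rightarrow> real^'m) \<Rightarrow> ('v \<Rightarrow> 'a \<Rightarrow> real^'n) \<Rightarrow> ('v \<Rightarrow> 'a \<Rightarrow> real^'n^'m) \<Rightarrow> bool" where
  "newton_selection \<mu> h j M \<longleftrightarrow>
     (\<forall>p. M p \<in> borel_measurable \<mu> \<and> (AE x in \<mu>. M p x \<in> clarke_jacobian h (j p x)))"

text \<open>
  In the following, \<open>T\<close> is the adjoint of \<open>S\<close> regarded as a map into \<open>V\<close>, i.e.
  \<open>j \<circ> T\<close> represents the adjoint.
\<close>

definition solves_system ::
  "((real^'n \<Rightarrow> real^2) \<Rightarrow> 'y::real_inner) \<Rightarrow> ('y \<Rightarrow> 'v::real_normed_vector) \<Rightarrow> 'y \<Rightarrow>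
   (real^2 \<Rightarrow> real^2) \<Rightarrow> ('v \<Rightarrow> real^'n \<Rightarrow> real^2) \<Rightarrow> 'y \<times> 'v \<Rightarrow> bool" where
  "solves_system S T z h j = (\<lambda>(y, p).
     y = S (\<lambda>x. h (j p x)) \<and> p = - T (y - z))"

definition newton_step ::
  "((real^'n \<Rightarrow> real^2) \<Rightarrow> 'y::real_inner) \<Rightarrow> ('y \<Rightarrow> 'v::real_normed_vector) \<Rightarrow> 'y \<Rightarrow>
   (real^2 \<Rightarrow> real^2) \<Rightarrow> ('v \<Rightarrow> real^'n \<Rightarrow> real^2) \<Rightarrow> ('v \<Rightarrow> real^'n \<Rightarrow> real^2^2) \<Rightarrow>
   'y \<times> 'v \<Rightarrow> 'y \<times> 'v \<Rightarrow> bool" where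
  "newton_step S T z h j M = (\<lambda>(y, p) (\<delta>y, \<delta>p).
     \<delta>y - S (\<lambda>x. M p x *v j \<delta>p x) = - y + S (\<lambda>x. h (j p x)) \<and>
     \<delta>p + T \<delta>y = - p - T (y - z))"

definition newton_iterates ::
  "((real^'n \<Rightarrow> real^2) \<Rightarrow> 'y::real_inner) \<Rightarrow> ('y \<Rightarrow> 'v::real_normed_vector) \<Rightarrow> 'y \<Rightarrow>
   (real^2 \<Rightarrow> real^2) \<Rightarrow> ('v \<Rightarrow> real^'n \<Rightarrow> real^2) \<Rightarrow> ('v \<Rightarrow> real^'n \<Rightarrow> real^2^2) \<Rightarrow>
   'y \<times> 'v \<Rightarrow> (nat \<Rightarrow> 'y \<times> 'v) \<Rightarrow> bool" where
  "newton_iterates S T z h j M w0 w \<longleftrightarrow>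
     w 0 = w0 \<and>
     (\<forall>k. \<exists>\<delta>. newton_step S T z h j M (w k) \<delta> \<and> w (Suc k) = w k + \<delta>)"

end

theory Submission
  imports Defs
begin

text \<open>
  A semismooth Newton method converges locally superlinearly if the Newton derivatives have uniformly
  bounded inverses and the linearization error is of lower order than the distance to the solution.
  Both properties come from the structure of the regularized map \<open>h\<close>.

  Bounded inverses. Proximal maps of convex functions are firmly nonexpansive, so \<open>h\<close> is monotone
  and Lipschitz continuous (\<open>h_reg_monotone\<close>, \<open>h_reg_lipschitz\<close>), and its Clarke Jacobians are
  bounded and have a nonnegative quadratic form. After elimination of \<open>\<delta>p\<close>, the Newton system has the
  operator \<open>I + S D\<^sub>N H(p) S\<^sup>*\<close> on \<open>Y\<close>, which is coercive with constant 1 for every \<open>p\<close>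
  (\<open>SDH_adjoint_nonneg\<close>). Hence every Newton system is uniquely solvable, and the error after a step
  is bounded by the linearization error at the current iterate (\<open>newton_step_error\<close>).

  Linearization error. The conjugate of the switching cost is the maximum of three quadratic
  functions, and its proximal point is given, whatever \<open>q\<close> is, by one of finitely many affine
  formulas in \<open>q\<close> (\<open>prox_conjugate_cases\<close>). So \<open>h\<close> is a continuous selection of finitely many affine
  maps. Such a map is linearized by its Clarke Jacobians at nearby points without any error
  (\<open>clarke_jacobian_exact\<close>), but in a neighbourhood of a size that depends on the point. For
  superposition operators the points with small neighbourhoods fill a set of small measure, and on
  sets of small measure the \<open>L\<^sup>2\<close> norm is small relative to the \<open>L\<^sup>r\<close> norm since \<open>r > 2\<close>; this yields
  \<open>superposition_semismooth\<close>.
\<close>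

section \<open>Clarke Jacobians and continuous selections of affine maps\<close>

lemma bounded_bilinear_matrix_vector_mult:
  "bounded_bilinear ((*v) :: real^'n^'m \<Rightarrow> real^'n \<Rightarrow> real^'m)"
  unfolding bilinear_conv_bounded_bilinear[symmetric] bilinear_def
  by (auto intro!: linearI simp: vec_eq_iff matrix_vector_mult_def sum_distrib_left sum.distrib algebra_simps)

lemmas tendsto_matrix_vector_mult = bounded_bilinear.tendsto[OF bounded_bilinear_matrix_vector_mult]

text \<open>
  The way in which all properties of the Clarke Jacobian are obtained below: a convex condition
  on matrices that survives limits of Jacobians holds on the whole convex hull.
\<close>

lemma clarke_jacobian_subset:
  assumes "\<And>s M. (\<And>n. f differentiable (at (s n))) \<Longrightarrow> s \<longlonglongrightarrow> q \<Longrightarrow>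
      (\<lambda>n. jacobian f (at (s n))) \<longlonglongrightarrow> M \<Longrightarrow> M \<in> C"
    and "convex C"
  shows "clarke_jacobian f q \<subseteq> C"
  unfolding clarke_jacobian_def using assms by (intro hull_minimal) auto

lemma jacobian_directional_limit:
  fixes f :: "real^'n \<Rightarrow> real^'m"
  assumes "f differentiable (at s)"
  shows "((\<lambda>t. (f (s + t *\<^sub>R d) - f s) /\<^sub>R t) \<longlongrightarrow> jacobian f (at s) *v d) (at 0)"
proof -
  let ?J = "jacobian f (at s)"
  have "(f has_derivative (*v) ?J) (at (s + 0 *\<^sub>R d))"
    using assms jacobian_works[of f "at s"] by simp
  moreover have "((\<lambda>t. s + t *\<^sub>R d) has_derivative (\<lambda>t. t *\<^sub>R d)) (at 0)"
    by (auto intro!: derivative_eq_intros)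
  ultimately have "((\<lambda>t. f (s + t *\<^sub>R d)) has_derivative (\<lambda>t. ?J *v (t *\<^sub>R d))) (at 0)"
    by (rule has_derivative_compose[rotated])
  then have "((\<lambda>t. (f (s + t *\<^sub>R d) - f s - ?J *v (t *\<^sub>R d)) /\<^sub>R \<bar>t\<bar>) \<longlongrightarrow> 0) (at 0)"
    by (simp add: has_derivative_at2 divide_inverse diff_diff_eq)
  then have "((\<lambda>t. norm ((f (s + t *\<^sub>R d) - f s - ?J *v (t *\<^sub>R d)) /\<^sub>R \<bar>t\<bar>)) \<longlongrightarrow> 0) (at 0)"
    by (rule tendsto_norm_zero)
  moreover have "\<forall>\<^sub>F t in at 0. norm ((f (s + t *\<^sub>R d) - f s - ?J *v (t *\<^sub>R d)) /\<^sub>R \<bar>t\<bar>)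
      = norm ((f (s + t *\<^sub>R d) - f s) /\<^sub>R t - ?J *v d)"
  proof (rule eventually_at_filter[THEN iffD2], intro always_eventually allI impI)
    fix t :: real assume "t \<noteq> 0"
    then have "(f (s + t *\<^sub>R d) - f s) /\<^sub>R t - ?J *v d
        = (f (s + t *\<^sub>R d) - f s - ?J *v (t *\<^sub>R d)) /\<^sub>R t"
      by (simp add: algebra_simps matrix_vector_mult_scaleR)
    then show "norm ((f (s + t *\<^sub>R d) - f s - ?J *v (t *\<^sub>R d)) /\<^sub>R \<bar>t\<bar>)
        = norm ((f (s + t *\<^sub>R d) - f s) /\<^sub>R t - ?J *v d)"
      by simp
  qed
  ultimately have "((\<lambda>t. norm ((f (s + t *\<^sub>R d) - f s) /\<^sub>R t - ?J *v d)) \<longlongrightarrow> 0) (at 0)"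
    by (rule Lim_transform_eventually)
  then show ?thesis
    by (simp add: tendsto_norm_zero_iff Lim_null[symmetric])
qed

lemma clarke_jacobian_norm_bound:
  fixes f :: "real^'n \<Rightarrow> real^'m"
  assumes lip: "L-lipschitz_on UNIV f" and M: "M \<in> clarke_jacobian f q"
  shows "norm (M *v d) \<le> L * norm d"
proof -
  have jac: "norm (jacobian f (at s) *v d) \<le> L * norm d" if "f differentiable (at s)" for s
  proof (rule tendsto_upperbound[OF tendsto_norm[OF jacobian_directional_limit[OF that]]])
    show "\<forall>\<^sub>F t in at 0. norm ((f (s + t *\<^sub>R d) - f s) /\<^sub>R t) \<le> L * norm d"
    proof (rule eventually_at_filter[THEN iffD2], intro always_eventually allI impI)
      fix t :: real assume "t \<noteq> 0"
      have "norm (f (s + t *\<^sub>R d) - f s) \<le> L * norm (t *\<^sub>R d)"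
        using lipschitz_onD[OF lip, of "s + t *\<^sub>R d" s] by (simp add: dist_norm)
      then show "norm ((f (s + t *\<^sub>R d) - f s) /\<^sub>R t) \<le> L * norm d"
        using \<open>t \<noteq> 0\<close> unfolding norm_scaleR abs_inverse inverse_eq_divide by (simp add: field_simps)
    qed
  qed simp
  have "clarke_jacobian f q \<subseteq> {M :: real^'n^'m. norm (M *v d) \<le> L * norm d}"
  proof (rule clarke_jacobian_subset)
    show "convex {M :: real^'n^'m. norm (M *v d) \<le> L * norm d}"
    proof (rule convexI)
      fix A B :: "real^'n^'m" and u v :: real
      assume *: "A \<in> {M :: real^'n^'m. norm (M *v d) \<le> L * norm d}" "B \<in> {M :: real^'n^'m. norm (M *v d) \<le> L * norm d}" "0 \<le> u" "0 \<le> v" "u + v = 1"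
      have "norm ((u *\<^sub>R A + v *\<^sub>R B) *v d) \<le> u * norm (A *v d) + v * norm (B *v d)"
        using * norm_triangle_ineq[of "u *\<^sub>R (A *v d)" "v *\<^sub>R (B *v d)"]
        by (simp add: matrix_vector_mult_add_rdistrib scaleR_matrix_vector_assoc[symmetric])
      also have "\<dots> \<le> L * norm d"
        using * by (intro convex_bound_le) auto
      finally show "u *\<^sub>R A + v *\<^sub>R B \<in> {M :: real^'n^'m. norm (M *v d) \<le> L * norm d}" by simp
    qed
  next
    fix s M assume s: "\<And>n. f differentiable (at (s n))" and M: "(\<lambda>n. jacobian f (at (s n))) \<longlonglongrightarrow> M"
    have "(\<lambda>n. norm (jacobian f (at (s n)) *v d)) \<longlonglongrightarrow> norm (M *v d)"
      by (intro tendsto_norm tendsto_matrix_vector_mult M tendsto_const)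
    then show "M \<in> {M :: real^'n^'m. norm (M *v d) \<le> L * norm d}"
      using jac[OF s] by (auto intro: LIMSEQ_le_const2)
  qed
  with M show ?thesis by auto
qed

lemma clarke_jacobian_monotone:
  fixes f :: "real^'n \<Rightarrow> real^'n"
  assumes mono: "\<And>p q. 0 \<le> (f p - f q) \<bullet> (p - q)" and M: "M \<in> clarke_jacobian f q"
  shows "0 \<le> (M *v d) \<bullet> d"
proof -
  have jac: "0 \<le> (jacobian f (at s) *v d) \<bullet> d" if "f differentiable (at s)" for s
  proof (rule tendsto_lowerbound[OF tendsto_inner[OF jacobian_directional_limit[OF that] tendsto_const]])
    show "\<forall>\<^sub>F t in at 0. 0 \<le> ((f (s + t *\<^sub>R d) - f s) /\<^sub>R t) \<bullet> d"
    proof (rule eventually_at_filter[THEN iffD2], intro always_eventually allI impI)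
      fix t :: real assume "t \<noteq> 0"
      have "0 \<le> t * ((f (s + t *\<^sub>R d) - f s) \<bullet> d)"
        using mono[of "s + t *\<^sub>R d" s] by simp
      then show "0 \<le> ((f (s + t *\<^sub>R d) - f s) /\<^sub>R t) \<bullet> d"
        using \<open>t \<noteq> 0\<close> by (simp add: zero_le_mult_iff) 
    qed
  qed simp
  have "clarke_jacobian f q \<subseteq> {M. 0 \<le> (M *v d) \<bullet> d}"
  proof (rule clarke_jacobian_subset)
    show "convex {M. 0 \<le> (M *v d) \<bullet> d}"
      by (rule convexI)
        (simp add: matrix_vector_mult_add_rdistrib scaleR_matrix_vector_assoc[symmetric] inner_add_left)
  next
    fix s M assume s: "\<And>n. f differentiable (at (s n))" and M: "(\<lambda>n. jacobian f (at (s n))) \<longlonglongrightarrow> M"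
    have "(\<lambda>n. (jacobian f (at (s n)) *v d) \<bullet> d) \<longlonglongrightarrow> (M *v d) \<bullet> d"
      by (intro tendsto_inner tendsto_matrix_vector_mult M tendsto_const)
    then show "M \<in> {M. 0 \<le> (M *v d) \<bullet> d}"
      using jac[OF s] by (auto intro: LIMSEQ_le_const)
  qed
  with M show ?thesis by auto
qed

text \<open>
  The domains of the pieces need no description: a finite family of affine maps, one of which
  gives the value at every point, already controls the derivatives of a continuous selection.
\<close>

definition piecewise_affine :: "('a::real_vector \<Rightarrow> 'b::real_vector) set \<Rightarrow> ('a \<Rightarrow> 'b) \<Rightarrow> bool" where
  "piecewise_affine \<Phi> f \<longleftrightarrow>
     finite \<Phi> \<and> (\<forall>\<phi>\<in>\<Phi>. linear (\<lambda>q. \<phi> q - \<phi> 0)) \<and> (\<forall>q. \<exists>\<phi>\<in>\<Phi>. f q = \<phi> q)"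

text \<open>
  The points at which only the pieces active there occur within the radius \<open>\<epsilon>\<close>. At such a point
  the function is exactly linearized by its Clarke Jacobians at all points of the open
  \<open>\<epsilon>\<close>-ball, see \<open>clarke_jacobian_exact\<close>.
  The radius shrinks near the kinks, so no \<open>\<epsilon>\<close> works for all points; but the sets are closed
  and exhaust the space as \<open>\<epsilon>\<close> tends to 0, which is what measure theory needs.
\<close>

definition isolating_points :: "('a::metric_space \<Rightarrow> 'b) set \<Rightarrow> ('a \<Rightarrow> 'b) \<Rightarrow> real \<Rightarrow> 'a set" where
  "isolating_points \<Phi> f \<epsilon> = {q. \<forall>\<phi>\<in>\<Phi>. f q = \<phi> q \<or> (\<forall>s. f s = \<phi> s \<longrightarrow> \<epsilon> \<le> dist s q)}"

lemma continuous_on_piece: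
  fixes \<phi> :: "'a::euclidean_space \<Rightarrow> 'b::real_normed_vector"
  assumes "linear (\<lambda>q. \<phi> q - \<phi> 0)"
  shows "continuous_on S \<phi>"
proof -
  have "continuous_on S (\<lambda>q. (\<phi> q - \<phi> 0) + \<phi> 0)"
    using assms by (intro continuous_on_add continuous_on_const linear_continuous_on linear_conv_bounded_linear[THEN iffD1])
  then show ?thesis by simp
qed

lemma closed_piece:
  fixes f :: "'a::euclidean_space \<Rightarrow> 'b::real_normed_vector"
  assumes "piecewise_affine \<Phi> f" "continuous_on UNIV f" "\<phi> \<in> \<Phi>"
  shows "closed {q. f q = \<phi> q}"
  using assms by (intro closed_Collect_eq[OF assms(2)] continuous_on_piece) (auto simp: piecewise_affine_def)

lemma closed_isolating_points:
  fixes f :: "'a::euclidean_space \<Rightarrow> 'b::real_normed_vector"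
  assumes "piecewise_affine \<Phi> f" "continuous_on UNIV f"
  shows "closed (isolating_points \<Phi> f \<epsilon>)"
proof -
  have "isolating_points \<Phi> f \<epsilon> =
      (\<Inter>\<phi>\<in>\<Phi>. {q. f q = \<phi> q} \<union> (\<Inter>s\<in>{s. f s = \<phi> s}. {q. \<epsilon> \<le> dist s q}))"
    by (auto simp: isolating_points_def)
  also have "closed \<dots>"
    by (intro closed_INT ballI closed_Un closed_piece[OF assms] closed_Collect_le continuous_intros)
  finally show ?thesis .
qed

lemma isolating_points_antimono: "\<epsilon> \<le> \<epsilon>' \<Longrightarrow> isolating_points \<Phi> f \<epsilon>' \<subseteq> isolating_points \<Phi> f \<epsilon>"
  by (fastforce simp: isolating_points_def)

lemma UN_isolating_points:
  fixes f :: "'a::euclidean_space \<Rightarrow> 'b::real_normed_vector"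
  assumes "piecewise_affine \<Phi> f" "continuous_on UNIV f"
  shows "(\<Union>n. isolating_points \<Phi> f (1 / real (Suc n))) = UNIV"
proof -
  have "\<exists>n. q \<in> isolating_points \<Phi> f (1 / real (Suc n))" for q
  proof -
    have "\<exists>e>0. f q \<noteq> \<phi> q \<longrightarrow> (\<forall>s. f s = \<phi> s \<longrightarrow> e \<le> dist s q)" if "\<phi> \<in> \<Phi>" for \<phi>
      using separate_point_closed[OF closed_piece[OF assms that], of q]
      by (cases "f q = \<phi> q") (auto simp: dist_commute intro: exI[of _ 1])
    then obtain e where e: "\<And>\<phi>. \<phi> \<in> \<Phi> \<Longrightarrow> 0 < e \<phi>"
        "\<And>\<phi> s. \<phi> \<in> \<Phi> \<Longrightarrow> f q \<noteq> \<phi> q \<Longrightarrow> f s = \<phi> s \<Longrightarrow> e \<phi> \<le> dist s q"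
      by metis
    define m where "m = Min (insert 1 (e ` \<Phi>))"
    have fin: "finite \<Phi>"
      using assms by (simp add: piecewise_affine_def)
    have "0 < m" "\<And>\<phi>. \<phi> \<in> \<Phi> \<Longrightarrow> m \<le> e \<phi>"
      using fin e by (auto simp: m_def)
    moreover from \<open>0 < m\<close> obtain n where "1 / real (Suc n) < m"
      using nat_approx_posE by blast
    ultimately have "1 / real (Suc n) \<le> dist s q" if "\<phi> \<in> \<Phi>" "f q \<noteq> \<phi> q" "f s = \<phi> s" for \<phi> s
      using e(2)[OF that] \<open>\<phi> \<in> \<Phi>\<close> by (meson less_imp_le order_trans)
    then show ?thesis
      by (auto simp: isolating_points_def)
  qed
  then show ?thesis by auto
qed

text \<open>
  The piece \<open>\<phi>\<close> may depend on the direction \<open>d\<close>: along the segment from \<open>s\<close> in this direction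
  some piece is met arbitrarily close to \<open>s\<close>, as there are only finitely many, and by continuity
  it is active at \<open>s\<close> and has the directional derivative of \<open>f\<close>. One direction at a time
  suffices below, so no single piece has to be found for all of them.
\<close>

lemma jacobian_along_piece:
  fixes f :: "real^'n \<Rightarrow> real^'m"
  assumes pa: "piecewise_affine \<Phi> f" and cont: "continuous_on UNIV f"
    and diff: "f differentiable (at s)"
  obtains \<phi> where "\<phi> \<in> \<Phi>" "f s = \<phi> s" "jacobian f (at s) *v d = \<phi> d - \<phi> 0"
proof -
  let ?act = "\<lambda>\<phi> t. f (s + t *\<^sub>R d) = \<phi> (s + t *\<^sub>R d)"
  have "\<exists>\<phi>\<in>\<Phi>. \<exists>\<^sub>F t in at (0::real). ?act \<phi> t"
  proof (rule ccontr)
    assume "\<not> ?thesis"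
    then have "\<forall>\<^sub>F t in at (0::real). \<forall>\<phi>\<in>\<Phi>. \<not> ?act \<phi> t"
      using pa by (intro eventually_ball_finite) (auto simp: piecewise_affine_def frequently_def)
    moreover have "\<forall>t. \<exists>\<phi>\<in>\<Phi>. ?act \<phi> t"
      using pa by (simp add: piecewise_affine_def)
    ultimately have "\<forall>\<^sub>F t in at (0::real). False"
      by (smt (verit) eventually_mono)
    then show False by simp
  qed
  then obtain \<phi> where \<phi>: "\<phi> \<in> \<Phi>" and freq: "\<exists>\<^sub>F t in at (0::real). ?act \<phi> t"
    by blast
  have lin: "linear (\<lambda>q. \<phi> q - \<phi> 0)"
    using pa \<phi> by (simp add: piecewise_affine_def)
  have line: "((\<lambda>t. g (s + t *\<^sub>R d)) \<longlongrightarrow> g s) (at 0)" if "continuous_on UNIV g" for g :: "real^'n \<Rightarrow> real^'m"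
  proof -
    have "((\<lambda>t. s + t *\<^sub>R d) \<longlongrightarrow> s + 0 *\<^sub>R d) (at 0)"
      by (intro tendsto_intros)
    moreover have "isCont g s"
      using that by (simp add: continuous_on_eq_continuous_at)
    ultimately show ?thesis
      by (intro isCont_tendsto_compose[of s g]) simp_all
  qed
  have eq: "f s = \<phi> s"
  proof (rule ccontr)
    assume "f s \<noteq> \<phi> s"
    then have "\<forall>\<^sub>F t in at (0::real). f (s + t *\<^sub>R d) - \<phi> (s + t *\<^sub>R d) \<noteq> 0"
      by (intro tendsto_imp_eventually_ne[OF tendsto_diff[OF line[OF cont] line[OF continuous_on_piece[OF lin]]]]) auto
    with freq show False
      by (simp add: frequently_def)
  qed
  have "jacobian f (at s) *v d = \<phi> d - \<phi> 0"
  proof (rule ccontr)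
    assume "jacobian f (at s) *v d \<noteq> \<phi> d - \<phi> 0"
    then have "\<forall>\<^sub>F t in at 0. (f (s + t *\<^sub>R d) - f s) /\<^sub>R t \<noteq> \<phi> d - \<phi> 0"
      by (rule tendsto_imp_eventually_ne[OF jacobian_directional_limit[OF diff]])
    moreover have "\<forall>\<^sub>F t in at (0::real). t \<noteq> 0"
      by (simp add: eventually_at_filter)
    ultimately have "\<forall>\<^sub>F t in at 0. \<not> ?act \<phi> t"
    proof eventually_elim
      case (elim t)
      have "\<phi> (s + t *\<^sub>R d) - \<phi> s = t *\<^sub>R (\<phi> d - \<phi> 0)"
        using linear_add[OF lin, of s "t *\<^sub>R d"] linear_scale[OF lin, of t d]
        by (simp add: algebra_simps)
      then show ?case
        using elim eq by auto
    qed
    with freq show False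
      by (simp add: frequently_def)
  qed
  with \<phi> eq show thesis by (rule that)
qed

text \<open>
  Semismoothness without remainder. At a point \<open>s\<close> of differentiability near \<open>q\<close>, the piece found
  along the direction \<open>s - q\<close> is active at \<open>s\<close>, hence also at \<open>q\<close>, so that \<open>f s - f q\<close> is its
  linear part applied to \<open>s - q\<close>. The resulting equation is affine in the matrix and passes to
  limits and convex combinations.
\<close>

lemma clarke_jacobian_exact:
  fixes f :: "real^'n \<Rightarrow> real^'m"
  assumes pa: "piecewise_affine \<Phi> f" and cont: "continuous_on UNIV f"
    and q: "q \<in> isolating_points \<Phi> f \<epsilon>" and near: "dist q' q < \<epsilon>"
    and M: "M \<in> clarke_jacobian f q'"
  shows "f q' - f q = M *v (q' - q)"
proof -
  have jac: "f s - f q = jacobian f (at s) *v (s - q)"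
    if diff: "f differentiable (at s)" and "dist s q < \<epsilon>" for s
  proof -
    obtain \<phi> where \<phi>: "\<phi> \<in> \<Phi>" "f s = \<phi> s" "jacobian f (at s) *v (s - q) = \<phi> (s - q) - \<phi> 0"
      using jacobian_along_piece[OF pa cont diff] .
    moreover have "f q = \<phi> q"
      using \<phi> q \<open>dist s q < \<epsilon>\<close> by (force simp: isolating_points_def)
    moreover have "linear (\<lambda>q. \<phi> q - \<phi> 0)"
      using pa \<phi> by (simp add: piecewise_affine_def)
    ultimately show ?thesis
      using linear_diff[of "\<lambda>q. \<phi> q - \<phi> 0" s q] by simp
  qed
  have "clarke_jacobian f q' \<subseteq> {M. f q' - f q = M *v (q' - q)}"
  proof (rule clarke_jacobian_subset)
    fix s M assume s: "\<And>n. f differentiable (at (s n))" "s \<longlonglongrightarrow> q'"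
      and M: "(\<lambda>n. jacobian f (at (s n))) \<longlonglongrightarrow> M"
    have lim: "(\<lambda>n. jacobian f (at (s n)) *v (s n - q)) \<longlonglongrightarrow> M *v (q' - q)"
      by (intro tendsto_matrix_vector_mult tendsto_intros s M)
    have ev: "\<forall>\<^sub>F n in sequentially. f (s n) - f q = jacobian f (at (s n)) *v (s n - q)"
      using order_tendstoD(2)[OF tendsto_dist[OF s(2) tendsto_const] near]
      by eventually_elim (rule jac[OF s(1)])
    have "(\<lambda>n. f (s n) - f q) \<longlonglongrightarrow> f q' - f q"
      using cont s(2)
      by (intro tendsto_intros isCont_tendsto_compose[of q' f]) (simp_all add: continuous_on_eq_continuous_at)
    from LIMSEQ_unique[OF Lim_transform_eventually[OF this ev] lim] have "f q' - f q = M *v (q' - q)" .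
    then show "M \<in> {M. f q' - f q = M *v (q' - q)}"
      by simp
  next
    show "convex {M. f q' - f q = M *v (q' - q)}"
    proof (rule convexI)
      fix A B :: "real^'n^'m" and u v :: real
      assume "A \<in> {M. f q' - f q = M *v (q' - q)}" "B \<in> {M. f q' - f q = M *v (q' - q)}" and "u + v = 1"
      then have A: "f q' - f q = A *v (q' - q)" and B: "f q' - f q = B *v (q' - q)" by simp_all
      have "(u *\<^sub>R A + v *\<^sub>R B) *v (q' - q) = u *\<^sub>R (f q' - f q) + v *\<^sub>R (f q' - f q)"
        unfolding matrix_vector_mult_add_rdistrib scaleR_matrix_vector_assoc[symmetric] A[symmetric] B[symmetric] ..
      also have "\<dots> = f q' - f q"
        using \<open>u + v = 1\<close> by (metis scaleR_add_left scaleR_one)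
      finally show "u *\<^sub>R A + v *\<^sub>R B \<in> {M. f q' - f q = M *v (q' - q)}"
        by simp
    qed
  qed
  with M show ?thesis by auto
qed

section \<open>Proximal maps of convex functions\<close>

text \<open>
  The minimum exists: where \<open>\<bar>w - q\<bar>\<^sup>2 > 2 \<gamma> (f q - c)\<close>, the quadratic term alone makes the
  objective larger than its value \<open>f q\<close> at \<open>q\<close>, so that it is enough to minimize over a compact
  ball.
\<close>

lemma prox_minimizes:
  fixes f :: "'a::euclidean_space \<Rightarrow> real"
  assumes conv: "convex_on UNIV f" and lower: "\<And>w. c \<le> f w" and "\<gamma> > 0"
  shows "f (prox \<gamma> f q) + 1 / (2 * \<gamma>) * (norm (prox \<gamma> f q - q))\<^sup>2
           \<le> f w + 1 / (2 * \<gamma>) * (norm (w - q))\<^sup>2"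
proof -
  define F where "F = (\<lambda>w. f w + 1 / (2 * \<gamma>) * (norm (w - q))\<^sup>2)"
  define R where "R = sqrt (2 * \<gamma> * (f q - c))"
  have "continuous_on UNIV f"
    using conv by (intro convex_on_continuous) auto
  then have "continuous_on (cball q R) F"
    unfolding F_def by (intro continuous_intros) (auto elim: continuous_on_subset)
  moreover have "0 \<le> R"
    using lower[of q] \<open>\<gamma> > 0\<close> by (simp add: R_def)
  ultimately obtain m where m: "\<And>w. w \<in> cball q R \<Longrightarrow> F m \<le> F w"
    using continuous_attains_inf[of "cball q R" F] by (metis cball_eq_empty compact_cball not_less)
  have "F m \<le> F w" for w
  proof (cases "w \<in> cball q R")
    case False
    then have "R\<^sup>2 < (norm (w - q))\<^sup>2"
      using \<open>0 \<le> R\<close> by (intro power_strict_mono) (auto simp: dist_norm norm_minus_commute)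
    then have "f q - c \<le> 1 / (2 * \<gamma>) * (norm (w - q))\<^sup>2"
      using lower[of q] \<open>\<gamma> > 0\<close> by (simp add: R_def field_simps)
    then have "F q \<le> F w"
      using lower[of w] by (simp add: F_def)
    then show ?thesis
      using m[of q] \<open>0 \<le> R\<close> by simp
  qed (rule m)
  then have "is_arg_min F (\<lambda>w. True) m"
    by (simp add: is_arg_min_linorder)
  then have "is_arg_min F (\<lambda>w. True) (prox \<gamma> f q)"
    unfolding prox_def F_def[symmetric] arg_min_def by (rule someI)
  then show ?thesis
    by (simp add: is_arg_min_linorder F_def)
qed

text \<open>
  The first-order condition for the minimizer \<open>P\<close>, from comparing it with \<open>P + t (w - P)\<close> and
  letting \<open>t\<close> tend to 0. It expresses that \<open>(q - P) / \<gamma>\<close> is a subgradient of \<open>f\<close> at \<open>P\<close>.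
\<close>

lemma prox_variational_inequality:
  fixes f :: "'a::euclidean_space \<Rightarrow> real"
  assumes conv: "convex_on UNIV f" and lower: "\<And>w. c \<le> f w" and "\<gamma> > 0"
  shows "(q - prox \<gamma> f q) \<bullet> (w - prox \<gamma> f q) \<le> \<gamma> * (f w - f (prox \<gamma> f q))"
proof -
  define P d where "P = prox \<gamma> f q" and "d = w - P"
  have "0 \<le> \<gamma> * (f w - f P) - (q - P) \<bullet> d + t * (norm d)\<^sup>2 / 2" if t: "0 < t" "t < 1" for t
  proof -
    have "f (P + t *\<^sub>R d) = f ((1 - t) *\<^sub>R P + t *\<^sub>R w)"
      by (simp add: d_def algebra_simps)
    also have "\<dots> \<le> (1 - t) * f P + t * f w"
      using conv t by (intro convex_onD) auto
    finally have "f P + 1 / (2 * \<gamma>) * (norm (P - q))\<^sup>2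
        \<le> (1 - t) * f P + t * f w + 1 / (2 * \<gamma>) * (norm (P + t *\<^sub>R d - q))\<^sup>2"
      using prox_minimizes[OF assms, of q "P + t *\<^sub>R d"] by (simp add: P_def)
    also have "(norm (P + t *\<^sub>R d - q))\<^sup>2 = (norm (P - q))\<^sup>2 - 2 * t * ((q - P) \<bullet> d) + t\<^sup>2 * (norm d)\<^sup>2"
      unfolding power2_norm_eq_inner by (simp add: inner_commute algebra_simps power2_eq_square)
    finally have "0 \<le> 2 * \<gamma> * (t * (f w - f P) + 1 / (2 * \<gamma>) * (t\<^sup>2 * (norm d)\<^sup>2 - 2 * t * ((q - P) \<bullet> d)))"
      using \<open>\<gamma> > 0\<close> by (intro mult_nonneg_nonneg) (auto simp: algebra_simps diff_divide_distrib add_divide_distrib)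
    also have "\<dots> = 2 * t * (\<gamma> * (f w - f P) - (q - P) \<bullet> d + t * (norm d)\<^sup>2 / 2)"
      using \<open>\<gamma> > 0\<close> by (simp add: field_simps power2_eq_square del: distrib_left_numeral)
    finally show ?thesis
      using t by (simp add: zero_le_mult_iff)
  qed
  then have "\<forall>\<^sub>F t in at_right 0. 0 \<le> \<gamma> * (f w - f P) - (q - P) \<bullet> d + t * (norm d)\<^sup>2 / 2"
    by (auto simp: eventually_at_right_field intro!: exI[of _ 1])
  moreover have "((\<lambda>t. \<gamma> * (f w - f P) - (q - P) \<bullet> d + t * (norm d)\<^sup>2 / 2) \<longlongrightarrow>
      \<gamma> * (f w - f P) - (q - P) \<bullet> d + 0 * (norm d)\<^sup>2 / 2) (at_right 0)"
    by (intro tendsto_intros) simp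
  ultimately have "0 \<le> \<gamma> * (f w - f P) - (q - P) \<bullet> d + 0 * (norm d)\<^sup>2 / 2"
    by (intro tendsto_lowerbound) auto
  then show ?thesis
    by (simp add: P_def d_def)
qed

lemma prox_firmly_nonexpansive:
  fixes f :: "'a::euclidean_space \<Rightarrow> real"
  assumes "convex_on UNIV f" and "\<And>w. c \<le> f w" and "\<gamma> > 0"
  shows "(norm (prox \<gamma> f q - prox \<gamma> f q'))\<^sup>2 \<le> (prox \<gamma> f q - prox \<gamma> f q') \<bullet> (q - q')"
  using prox_variational_inequality[OF assms, of q "prox \<gamma> f q'"]
    prox_variational_inequality[OF assms, of q' "prox \<gamma> f q"]
  by (simp add: power2_norm_eq_inner inner_commute algebra_simps)

text \<open>
  Where \<open>f\<close> is quadratic along a line through the proximal point, the variational inequality holds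
  for small positive and negative multiples of \<open>u\<close> and becomes the usual stationarity equation.
  This gives the proximal point of a piecewise quadratic function without computing subdifferentials
  at kinks.
\<close>

lemma prox_stationary_along:
  fixes f :: "'a::euclidean_space \<Rightarrow> real"
  assumes "convex_on UNIV f" and "\<And>w. c \<le> f w" and "\<gamma> > 0"
    and quad: "\<forall>\<^sub>F t in nhds 0. f (prox \<gamma> f q + t *\<^sub>R u) = f (prox \<gamma> f q) + a * t + b * t\<^sup>2"
  shows "(q - prox \<gamma> f q) \<bullet> u = \<gamma> * a"
proof -
  define s where "s = (q - prox \<gamma> f q) \<bullet> u - \<gamma> * a"
  obtain \<epsilon> where "\<epsilon> > 0"
    and \<epsilon>: "\<And>t. \<bar>t\<bar> < \<epsilon> \<Longrightarrow> f (prox \<gamma> f q + t *\<^sub>R u) = f (prox \<gamma> f q) + a * t + b * t\<^sup>2"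
    using quad by (auto simp: eventually_nhds_metric dist_real_def)
  have ineq: "t * s \<le> \<gamma> * b * t\<^sup>2" if "\<bar>t\<bar> < \<epsilon>" for t
    using prox_variational_inequality[OF assms(1-3), of q "prox \<gamma> f q + t *\<^sub>R u"] \<epsilon>[OF that]
    by (simp add: s_def algebra_simps)
  have "s \<le> \<gamma> * b * t" "- s \<le> \<gamma> * b * t" if "0 < t" "t < \<epsilon>" for t
  proof -
    have "t * s \<le> t * (\<gamma> * b * t)" "t * - s \<le> t * (\<gamma> * b * t)"
      using ineq[of t] ineq[of "-t"] that by (simp_all add: power2_eq_square mult_ac)
    then show "s \<le> \<gamma> * b * t" "- s \<le> \<gamma> * b * t"
      using \<open>0 < t\<close> by (simp_all only: mult_le_cancel_left_pos)
  qed
  then have ev: "\<forall>\<^sub>F t in at_right 0. s \<le> \<gamma> * b * t" "\<forall>\<^sub>F t in at_right 0. - s \<le> \<gamma> * b * t"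
    using \<open>\<epsilon> > 0\<close> by (auto simp: eventually_at_right_field intro!: exI[of _ \<epsilon>])
  have lim: "((\<lambda>t. \<gamma> * b * t) \<longlongrightarrow> \<gamma> * b * 0) (at_right 0)"
    by (intro tendsto_intros)
  show ?thesis
    using tendsto_lowerbound[OF lim ev(1)] tendsto_lowerbound[OF lim ev(2)] by (simp add: s_def)
qed

lemma convex_on_fenchel_conjugate:
  fixes f :: "'a::euclidean_space \<Rightarrow> real"
  assumes bdd: "\<And>q. bdd_above (range (\<lambda>v. v \<bullet> q - f v))"
  shows "convex_on UNIV (fenchel_conjugate f)"
proof (intro convex_onI)
  fix t :: real and x y :: 'a assume t: "0 < t" "t < 1"
  have "v \<bullet> ((1 - t) *\<^sub>R x + t *\<^sub>R y) - f v
      \<le> (1 - t) * fenchel_conjugate f x + t * fenchel_conjugate f y" for v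
  proof -
    have "(1 - t) * (v \<bullet> x - f v) + t * (v \<bullet> y - f v)
        \<le> (1 - t) * fenchel_conjugate f x + t * fenchel_conjugate f y"
      unfolding fenchel_conjugate_def using t bdd
      by (intro add_mono mult_left_mono cSUP_upper) auto
    then show ?thesis by (simp add: algebra_simps)
  qed
  then show "fenchel_conjugate f ((1 - t) *\<^sub>R x + t *\<^sub>R y)
      \<le> (1 - t) * fenchel_conjugate f x + t * fenchel_conjugate f y"
    unfolding fenchel_conjugate_def[of f "(1 - t) *\<^sub>R x + t *\<^sub>R y"] by (intro cSUP_least) auto
qed auto

section \<open>The regularized switching map\<close>

text \<open>
  The three terms of the maximum come from the controls with \<open>v\<^sub>2 = 0\<close>, with \<open>v\<^sub>1 = 0\<close>, and with
  both components free at the price \<open>\<beta>\<close>.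
\<close>

lemma fenchel_conjugate_switching_cost:
  assumes "\<alpha> > 0" "\<beta> > 0"
  shows "fenchel_conjugate (switching_cost \<alpha> \<beta>) q =
    (max ((q $ 1)\<^sup>2) (max ((q $ 2)\<^sup>2) ((q $ 1)\<^sup>2 + (q $ 2)\<^sup>2 - 2 * \<alpha> * \<beta>))) / (2 * \<alpha>)"
    (is "_ = ?m / _")
proof (rule antisym)
  have young: "2 * \<alpha> * (a * b) \<le> \<alpha>\<^sup>2 * a\<^sup>2 + b\<^sup>2" for a b :: real
    using zero_le_power2[of "\<alpha> * a - b"] by (simp add: power2_eq_square algebra_simps)
  have "v \<bullet> q - switching_cost \<alpha> \<beta> v \<le> ?m / (2 * \<alpha>)" for v
  proof -
    have "2 * \<alpha> * (v \<bullet> q - switching_cost \<alpha> \<beta> v) \<le> ?m"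
      using young[of "v $ 1" "q $ 1"] young[of "v $ 2" "q $ 2"]
      by (auto simp: switching_cost_def abs0_def inner_vec_def sum_2 algebra_simps power2_eq_square)
    then show ?thesis
      using assms by (simp add: field_simps)
  qed
  then show "fenchel_conjugate (switching_cost \<alpha> \<beta>) q \<le> ?m / (2 * \<alpha>)"
    unfolding fenchel_conjugate_def by (intro cSUP_least) auto
next
  have at: "v \<bullet> q - switching_cost \<alpha> \<beta> v \<le> fenchel_conjugate (switching_cost \<alpha> \<beta>) q" for v
    unfolding fenchel_conjugate_def using assms
    by (intro cSUP_upper bdd_above_switching_cost) auto
  have "(q $ 1)\<^sup>2 / (2 * \<alpha>) \<le> fenchel_conjugate (switching_cost \<alpha> \<beta>) q"
    using at[of "vector [q $ 1 / \<alpha>, 0]"] assms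
    by (simp add: switching_cost_def abs0_def inner_vec_def sum_2 power2_eq_square field_simps)
  moreover have "(q $ 2)\<^sup>2 / (2 * \<alpha>) \<le> fenchel_conjugate (switching_cost \<alpha> \<beta>) q"
    using at[of "vector [0, q $ 2 / \<alpha>]"] assms
    by (simp add: switching_cost_def abs0_def inner_vec_def sum_2 power2_eq_square field_simps)
  moreover have "((q $ 1)\<^sup>2 + (q $ 2)\<^sup>2 - 2 * \<alpha> * \<beta>) / (2 * \<alpha>) \<le> fenchel_conjugate (switching_cost \<alpha> \<beta>) q"
  proof (rule order_trans[OF _ at[of "(1 / \<alpha>) *\<^sub>R q"]])
    have "\<beta> * abs0 x \<le> \<beta>" for x
      using assms by (simp add: abs0_def)
    from this[of "q $ 1 * q $ 2 / (\<alpha> * \<alpha>)"]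
    show "((q $ 1)\<^sup>2 + (q $ 2)\<^sup>2 - 2 * \<alpha> * \<beta>) / (2 * \<alpha>) \<le> (1 / \<alpha>) *\<^sub>R q \<bullet> q - switching_cost \<alpha> \<beta> ((1 / \<alpha>) *\<^sub>R q)"
      using assms
      by (simp add: switching_cost_def inner_vec_def sum_2 power2_eq_square field_simps)
  qed
  ultimately show "?m / (2 * \<alpha>) \<le> fenchel_conjugate (switching_cost \<alpha> \<beta>) q"
    unfolding max_def by presburger
qed

context
  fixes \<alpha> \<beta> \<gamma> :: real and q w :: "real^2" and G :: "real^2 \<Rightarrow> real"
  assumes pos: "\<alpha> > 0" "\<beta> > 0" "\<gamma> > 0"
  defines "G \<equiv> fenchel_conjugate (switching_cost \<alpha> \<beta>)"
  defines "w \<equiv> prox \<gamma> G q"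
begin

lemma convex_conjugate: "convex_on UNIV G"
  unfolding G_def using pos by (intro convex_on_fenchel_conjugate bdd_above_switching_cost) auto

lemma conjugate_nonneg: "0 \<le> G v"
  unfolding G_def fenchel_conjugate_switching_cost[OF pos(1,2)] using pos by (simp add: le_max_iff_disj)

lemma conjugate_eq:
  fixes i k :: 2
  assumes "i \<noteq> k"
  shows "G v = (max ((v $ i)\<^sup>2) (max ((v $ k)\<^sup>2) ((v $ i)\<^sup>2 + (v $ k)\<^sup>2 - 2 * \<alpha> * \<beta>))) / (2 * \<alpha>)"
  using exhaust_2[of i] exhaust_2[of k] assms pos
  by (auto simp: G_def fenchel_conjugate_switching_cost max.left_commute add.commute)

lemma prox_conjugate_stationary:
  assumes "\<forall>\<^sub>F t in nhds 0. G (w + t *\<^sub>R u) = G w + a * t + b * t\<^sup>2"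
  shows "(q - w) \<bullet> u = \<gamma> * a"
  using prox_stationary_along[OF convex_conjugate conjugate_nonneg pos(3)] assms by (simp add: w_def)

lemma eventually_along:
  fixes i :: 2
  assumes "c < (w $ i)\<^sup>2"
  shows "\<forall>\<^sub>F t in nhds (0::real). c < (w $ i + t)\<^sup>2"
proof -
  have "((\<lambda>t. (w $ i + t)\<^sup>2) \<longlongrightarrow> (w $ i + 0)\<^sup>2) (nhds 0)"
    by (intro tendsto_intros filterlim_ident)
  then show ?thesis
    using assms by (intro order_tendstoD(1)) auto
qed

lemma eventually_along':
  fixes i :: 2
  assumes "(w $ i)\<^sup>2 < c"
  shows "\<forall>\<^sub>F t in nhds (0::real). (w $ i + t)\<^sup>2 < c"
proof -
  have "((\<lambda>t. (w $ i + t)\<^sup>2) \<longlongrightarrow> (w $ i + 0)\<^sup>2) (nhds 0)"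
    by (intro tendsto_intros filterlim_ident)
  then show ?thesis
    using assms by (intro order_tendstoD(2)) auto
qed

text \<open>
  Along the axis \<open>i\<close> the conjugate is \<open>v\<^sub>i\<^sup>2 / (2 \<alpha>)\<close> plus a constant, as long as \<open>v\<^sub>i\<close> dominates the
  other component or its square exceeds the threshold \<open>2 \<alpha> \<beta>\<close>.
\<close>

lemma prox_conjugate_active:
  fixes i k :: 2
  assumes "i \<noteq> k" and dom: "(w $ k)\<^sup>2 < (w $ i)\<^sup>2 \<or> 2 * \<alpha> * \<beta> < (w $ i)\<^sup>2"
  shows "w $ i = \<alpha> / (\<alpha> + \<gamma>) * q $ i"
proof -
  have split: "G v = ((v $ i)\<^sup>2 + max 0 ((w $ k)\<^sup>2 - 2 * \<alpha> * \<beta>)) / (2 * \<alpha>)"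
    if "v $ k = w $ k" "(w $ k)\<^sup>2 < (v $ i)\<^sup>2 \<or> 2 * \<alpha> * \<beta> < (v $ i)\<^sup>2" for v
    using that by (auto simp: conjugate_eq[OF \<open>i \<noteq> k\<close>] max_def)
  have "\<forall>\<^sub>F t in nhds (0::real). (w $ k)\<^sup>2 < (w $ i + t)\<^sup>2 \<or> 2 * \<alpha> * \<beta> < (w $ i + t)\<^sup>2"
    using dom by (auto intro: eventually_along eventually_mono)
  then have "\<forall>\<^sub>F t in nhds 0. G (w + t *\<^sub>R axis i 1) = G w + w $ i / \<alpha> * t + 1 / (2 * \<alpha>) * t\<^sup>2"
  proof eventually_elim
    case (elim t)
    have "G (w + t *\<^sub>R axis i 1) = ((w $ i + t)\<^sup>2 + max 0 ((w $ k)\<^sup>2 - 2 * \<alpha> * \<beta>)) / (2 * \<alpha>)"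
      using elim \<open>i \<noteq> k\<close> by (subst split) (auto simp: axis_def)
    then show ?case
      using pos split[OF refl dom] by (simp add: field_simps power2_eq_square)
  qed
  from prox_conjugate_stationary[OF this] have "q $ i - w $ i = \<gamma> * (w $ i / \<alpha>)"
    by (simp add: inner_axis)
  then show ?thesis
    using pos by (simp add: field_simps)
qed

text \<open>
  Where the component \<open>k\<close> is dominated and below the threshold, the conjugate is constant along the
  axis \<open>k\<close>.
\<close>

lemma prox_conjugate_inactive:
  fixes i k :: 2
  assumes "i \<noteq> k" and "(w $ k)\<^sup>2 < (w $ i)\<^sup>2" "(w $ k)\<^sup>2 < 2 * \<alpha> * \<beta>"
  shows "w $ k = q $ k"
proof -
  have flat: "G v = (w $ i)\<^sup>2 / (2 * \<alpha>)"
    if "v $ i = w $ i" "(v $ k)\<^sup>2 < (w $ i)\<^sup>2" "(v $ k)\<^sup>2 < 2 * \<alpha> * \<beta>" for v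
    using that by (auto simp: conjugate_eq[OF \<open>i \<noteq> k\<close>] max_def)
  have "\<forall>\<^sub>F t in nhds 0. G (w + t *\<^sub>R axis k 1) = G w + 0 * t + 0 * t\<^sup>2"
    using eventually_along'[OF assms(2)] eventually_along'[OF assms(3)]
  proof eventually_elim
    case (elim t)
    then show ?case
      using \<open>i \<noteq> k\<close> by (simp add: flat assms axis_def)
  qed
  from prox_conjugate_stationary[OF this] show ?thesis
    by (simp add: inner_axis)
qed

text \<open>
  On the diagonals below the threshold the conjugate has, away from the origin, a kink transversally,
  but it is quadratic along the diagonal itself.
\<close>

lemma prox_conjugate_diagonal:
  assumes \<sigma>: "\<sigma> \<in> {1, -1}" and "w $ 1 = \<sigma> * w $ 2" and "(w $ 2)\<^sup>2 < 2 * \<alpha> * \<beta>"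
  shows "w $ 2 = \<alpha> / (2 * \<alpha> + \<gamma>) * (\<sigma> * q $ 1 + q $ 2)"
proof -
  let ?u = "vector [\<sigma>, 1] :: real^2"
  have diag: "G v = (v $ 2)\<^sup>2 / (2 * \<alpha>)" if "v $ 1 = \<sigma> * v $ 2" "(v $ 2)\<^sup>2 < 2 * \<alpha> * \<beta>" for v
    using that \<sigma> by (auto simp: conjugate_eq[of 1 2] max_def)
  have "\<forall>\<^sub>F t in nhds 0. G (w + t *\<^sub>R ?u) = G w + w $ 2 / \<alpha> * t + 1 / (2 * \<alpha>) * t\<^sup>2"
    using eventually_along'[OF assms(3)]
  proof eventually_elim
    case (elim t)
    have "G (w + t *\<^sub>R ?u) = (w $ 2 + t)\<^sup>2 / (2 * \<alpha>)"
      using elim assms by (subst diag) (auto simp: algebra_simps)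
    then show ?case
      using pos diag[OF assms(2,3)] by (simp add: field_simps power2_eq_square)
  qed
  then have "(q - w) \<bullet> ?u = \<gamma> * (w $ 2 / \<alpha>)"
    by (rule prox_conjugate_stationary)
  moreover have "\<sigma> * \<sigma> = 1"
    using \<sigma> by auto
  ultimately show ?thesis
    using pos assms(2) by (auto simp: inner_vec_def sum_2 field_simps)
qed

text \<open>
  Unless the two components of \<open>w\<close> have the same modulus below the threshold, each of them is either
  determined by a stationarity equation along its axis or sits at a kink \<open>\<plusminus>c\<close>.
\<close>

lemma prox_conjugate_cases:
  defines "c \<equiv> sqrt (2 * \<alpha> * \<beta>)"
  shows "(\<forall>i. w $ i \<in> {\<alpha> / (\<alpha> + \<gamma>) * q $ i, q $ i, c, - c}) \<or>
    (\<exists>\<sigma>\<in>{1, -1}. w $ 1 = \<sigma> * (\<alpha> / (2 * \<alpha> + \<gamma>) * (\<sigma> * q $ 1 + q $ 2)) \<and>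
      w $ 2 = \<alpha> / (2 * \<alpha> + \<gamma>) * (\<sigma> * q $ 1 + q $ 2))"
proof -
  have c: "x \<in> {c, - c}" if "x\<^sup>2 = 2 * \<alpha> * \<beta>" for x :: real
    using that pos power2_eq_iff[of x c] by (simp add: c_def)
  have off: "w $ i = \<alpha> / (\<alpha> + \<gamma>) * q $ i \<and> w $ k \<in> {\<alpha> / (\<alpha> + \<gamma>) * q $ k, q $ k, c, - c}"
    if "(w $ k)\<^sup>2 < (w $ i)\<^sup>2" for i k :: 2
  proof -
    have "i \<noteq> k"
      using that by auto
    then show ?thesis
      using that prox_conjugate_active[of i k] prox_conjugate_active[of k i]
        prox_conjugate_inactive[of i k] c[of "w $ k"] by fastforce
  qed
  consider "(w $ 2)\<^sup>2 < (w $ 1)\<^sup>2" | "(w $ 1)\<^sup>2 < (w $ 2)\<^sup>2"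
    | "(w $ 1)\<^sup>2 = (w $ 2)\<^sup>2" "2 * \<alpha> * \<beta> < (w $ 2)\<^sup>2"
    | "(w $ 1)\<^sup>2 = (w $ 2)\<^sup>2" "(w $ 2)\<^sup>2 = 2 * \<alpha> * \<beta>"
    | "(w $ 1)\<^sup>2 = (w $ 2)\<^sup>2" "(w $ 2)\<^sup>2 < 2 * \<alpha> * \<beta>"
    by linarith
  then show ?thesis
  proof cases
    case 1
    then show ?thesis using off[of 2 1] by (auto simp: forall_2)
  next
    case 2
    then show ?thesis using off[of 1 2] by (auto simp: forall_2)
  next
    case 3
    then show ?thesis
      using prox_conjugate_active[of 1 2] prox_conjugate_active[of 2 1] by (auto simp: forall_2)
  next
    case 4
    then show ?thesis
      using c[of "w $ 1"] c[of "w $ 2"] by (auto simp: forall_2)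
  next
    case 5
    then have "\<exists>\<sigma>\<in>{1, -1}. w $ 1 = \<sigma> * w $ 2"
      by (auto simp: power2_eq_iff)
    then obtain \<sigma> where "\<sigma> \<in> {1, -1}" "w $ 1 = \<sigma> * w $ 2" ..
    with prox_conjugate_diagonal[OF this 5(2)] show ?thesis by metis
  qed
qed

end

lemma
  assumes "\<alpha> > 0" "\<beta> > 0" "\<gamma> > 0"
  shows h_reg_monotone: "0 \<le> (h_reg \<alpha> \<beta> \<gamma> p - h_reg \<alpha> \<beta> \<gamma> q) \<bullet> (p - q)"
    and h_reg_norm_diff: "norm (h_reg \<alpha> \<beta> \<gamma> p - h_reg \<alpha> \<beta> \<gamma> q) \<le> 1 / \<gamma> * norm (p - q)"
proof -
  define P where "P = prox \<gamma> (fenchel_conjugate (switching_cost \<alpha> \<beta>))"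
  define a d where "a = P p - P q" and "d = p - q"
  \<comment> \<open>firm nonexpansiveness of the proximal map passes to its complement \<open>q - prox q\<close>\<close>
  have firm: "(norm a)\<^sup>2 \<le> a \<bullet> d"
    unfolding P_def a_def d_def
    by (rule prox_firmly_nonexpansive[OF convex_conjugate conjugate_nonneg]) (use assms in auto)
  have h: "h_reg \<alpha> \<beta> \<gamma> p - h_reg \<alpha> \<beta> \<gamma> q = (1 / \<gamma>) *\<^sub>R (d - a)"
    by (simp add: h_reg_def P_def a_def d_def algebra_simps)
  have "(norm (d - a))\<^sup>2 = (norm d)\<^sup>2 - 2 * (a \<bullet> d) + (norm a)\<^sup>2"
    unfolding power2_norm_eq_inner by (simp add: inner_commute algebra_simps)
  with firm have sq: "(norm (d - a))\<^sup>2 + a \<bullet> d \<le> (norm d)\<^sup>2"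
    by simp
  moreover have "0 \<le> a \<bullet> d"
    using firm zero_le_power2[of "norm a"] by linarith
  ultimately have "(norm (d - a))\<^sup>2 \<le> (norm d)\<^sup>2"
    by linarith
  then have "norm (d - a) \<le> norm d"
    by (rule power2_le_imp_le) simp
  then show "norm (h_reg \<alpha> \<beta> \<gamma> p - h_reg \<alpha> \<beta> \<gamma> q) \<le> 1 / \<gamma> * norm (p - q)"
    using assms by (simp add: h d_def[symmetric] divide_right_mono)
  have "a \<bullet> d \<le> (norm d)\<^sup>2"
    using sq zero_le_power2[of "norm (d - a)"] by linarith
  then have "0 \<le> (d - a) \<bullet> d"
    by (simp add: power2_norm_eq_inner algebra_simps)
  then show "0 \<le> (h_reg \<alpha> \<beta> \<gamma> p - h_reg \<alpha> \<beta> \<gamma> q) \<bullet> (p - q)"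
    using assms by (simp add: h d_def[symmetric])
qed

lemma h_reg_lipschitz:
  assumes "\<alpha> > 0" "\<beta> > 0" "\<gamma> > 0"
  shows "(1 / \<gamma>)-lipschitz_on UNIV (h_reg \<alpha> \<beta> \<gamma>)"
  using assms h_reg_norm_diff[OF assms] by (intro lipschitz_onI) (simp_all add: dist_norm)

definition prox_coordinate_pieces :: "real \<Rightarrow> real \<Rightarrow> real \<Rightarrow> (real \<Rightarrow> real) set" where
  "prox_coordinate_pieces \<alpha> \<beta> \<gamma> =
     {\<lambda>x. \<alpha> / (\<alpha> + \<gamma>) * x, \<lambda>x. x, \<lambda>x. sqrt (2 * \<alpha> * \<beta>), \<lambda>x. - sqrt (2 * \<alpha> * \<beta>)}"

text \<open>
  The second family gives the proximal points on the two diagonals. In the first one all combinations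
  of coordinate pieces are collected, including those which never occur: only finiteness matters.
\<close>

definition prox_pieces :: "real \<Rightarrow> real \<Rightarrow> real \<Rightarrow> (real^2 \<Rightarrow> real^2) set" where
  "prox_pieces \<alpha> \<beta> \<gamma> =
     (\<lambda>(\<phi>, \<psi>) q. vector [\<phi> (q $ 1), \<psi> (q $ 2)]) `
       (prox_coordinate_pieces \<alpha> \<beta> \<gamma> \<times> prox_coordinate_pieces \<alpha> \<beta> \<gamma>) \<union>
     (\<lambda>\<sigma> q. (\<alpha> / (2 * \<alpha> + \<gamma>) * (\<sigma> * q $ 1 + q $ 2)) *\<^sub>R vector [\<sigma>, 1]) ` {1, -1}"

lemma vec2_eq_iff: "(u = v) \<longleftrightarrow> u $ 1 = v $ 1 \<and> u $ 2 = v $ 2" for u v :: "'a^2"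
  by (simp add: vec_eq_iff forall_2)

lemma piecewise_affine_h_reg:
  assumes "\<alpha> > 0" "\<beta> > 0" "\<gamma> > 0"
  shows "piecewise_affine ((\<lambda>\<phi> q. (1 / \<gamma>) *\<^sub>R (q - \<phi> q)) ` prox_pieces \<alpha> \<beta> \<gamma>) (h_reg \<alpha> \<beta> \<gamma>)"
  unfolding piecewise_affine_def
proof (intro conjI ballI allI)
  show "finite ((\<lambda>\<phi> q. (1 / \<gamma>) *\<^sub>R (q - \<phi> q)) ` prox_pieces \<alpha> \<beta> \<gamma>)"
    by (simp add: prox_pieces_def prox_coordinate_pieces_def)
next
  fix \<psi> assume "\<psi> \<in> (\<lambda>\<phi> q. (1 / \<gamma>) *\<^sub>R (q - \<phi> q)) ` prox_pieces \<alpha> \<beta> \<gamma>"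
  then show "linear (\<lambda>q. \<psi> q - \<psi> 0)"
    by (auto simp: prox_pieces_def prox_coordinate_pieces_def intro!: linearI)
      (simp_all add: vec2_eq_iff algebra_simps add_divide_distrib diff_divide_distrib)
next
  fix q
  define w where "w = prox \<gamma> (fenchel_conjugate (switching_cost \<alpha> \<beta>)) q"
  have "\<exists>\<phi>\<in>prox_pieces \<alpha> \<beta> \<gamma>. w = \<phi> q"
    using prox_conjugate_cases[OF assms, of q, folded w_def]
  proof
    assume *: "\<forall>i. w $ i \<in> {\<alpha> / (\<alpha> + \<gamma>) * q $ i, q $ i, sqrt (2 * \<alpha> * \<beta>), - sqrt (2 * \<alpha> * \<beta>)}"
    have "\<exists>\<phi>\<in>prox_coordinate_pieces \<alpha> \<beta> \<gamma>. w $ i = \<phi> (q $ i)" for i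
      using *[rule_format, of i] by (auto simp: prox_coordinate_pieces_def)
    then obtain \<phi> where \<phi>: "\<And>i. \<phi> i \<in> prox_coordinate_pieces \<alpha> \<beta> \<gamma>" "\<And>i. w $ i = \<phi> i (q $ i)"
      by metis
    have "w = (\<lambda>(\<phi>, \<psi>) q. vector [\<phi> (q $ 1), \<psi> (q $ 2)]) (\<phi> 1, \<phi> 2) q"
      by (simp add: vec2_eq_iff \<phi>(2))
    then show ?thesis
      unfolding prox_pieces_def using \<phi>(1) by blast
  next
    assume "\<exists>\<sigma>\<in>{1, -1}. w $ 1 = \<sigma> * (\<alpha> / (2 * \<alpha> + \<gamma>) * (\<sigma> * q $ 1 + q $ 2)) \<and>
      w $ 2 = \<alpha> / (2 * \<alpha> + \<gamma>) * (\<sigma> * q $ 1 + q $ 2)"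
    then obtain \<sigma> where \<sigma>: "\<sigma> \<in> {1, -1}"
      and "w $ 1 = \<sigma> * (\<alpha> / (2 * \<alpha> + \<gamma>) * (\<sigma> * q $ 1 + q $ 2))"
      and "w $ 2 = \<alpha> / (2 * \<alpha> + \<gamma>) * (\<sigma> * q $ 1 + q $ 2)" by blast
    then have "w = (\<lambda>q. (\<alpha> / (2 * \<alpha> + \<gamma>) * (\<sigma> * q $ 1 + q $ 2)) *\<^sub>R vector [\<sigma>, 1]) q"
      by (simp add: vec2_eq_iff)
    moreover have "(\<lambda>q. (\<alpha> / (2 * \<alpha> + \<gamma>) * (\<sigma> * q $ 1 + q $ 2)) *\<^sub>R vector [\<sigma>, 1]) \<in> prox_pieces \<alpha> \<beta> \<gamma>"
      unfolding prox_pieces_def using \<sigma> by (intro UnI2 imageI)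
    ultimately show ?thesis ..
  qed
  then show "\<exists>\<psi>\<in>(\<lambda>\<phi> q. (1 / \<gamma>) *\<^sub>R (q - \<phi> q)) ` prox_pieces \<alpha> \<beta> \<gamma>. h_reg \<alpha> \<beta> \<gamma> q = \<psi> q"
    by (auto simp: h_reg_def w_def)
qed

section \<open>Superposition operators between Lebesgue spaces\<close>

lemma Lp_fun_2_iff:
  "f \<in> Lp_fun 2 \<mu> \<longleftrightarrow> f \<in> borel_measurable \<mu> \<and> integrable \<mu> (\<lambda>x. (norm (f x))\<^sup>2)"
  by (simp add: Lp_fun_def)

lemma Lp_norm_2_squared: "(Lp_norm 2 \<mu> f)\<^sup>2 = (\<integral>x. (norm (f x))\<^sup>2 \<partial>\<mu>)"
  by (simp add: Lp_norm_def powr_half_sqrt)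

lemma Lp_norm_nonneg: "0 \<le> Lp_norm p \<mu> f"
  by (simp add: Lp_norm_def)

lemma Lp_norm_powr:
  assumes "p > 0"
  shows "Lp_norm p \<mu> f powr p = (\<integral>x. norm (f x) powr p \<partial>\<mu>)"
  using assms by (simp add: Lp_norm_def powr_powr)

lemma Lp_norm_cong_AE:
  assumes "f \<in> borel_measurable \<mu>" "g \<in> borel_measurable \<mu>" "AE x in \<mu>. f x = g x"
  shows "Lp_norm p \<mu> f = Lp_norm p \<mu> g"
proof -
  have "(\<integral>x. norm (f x) powr p \<partial>\<mu>) = (\<integral>x. norm (g x) powr p \<partial>\<mu>)"
    using assms by (intro integral_cong_AE) auto
  then show ?thesis by (simp add: Lp_norm_def)
qed

lemma Lp_fun_2_dominated:
  assumes "f \<in> borel_measurable \<mu>" "g \<in> Lp_fun 2 \<mu>" "AE x in \<mu>. norm (f x) \<le> C * norm (g x)"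
  shows "f \<in> Lp_fun 2 \<mu>"
proof -
  have "integrable \<mu> (\<lambda>x. (norm (f x))\<^sup>2)"
  proof (rule Bochner_Integration.integrable_bound)
    show "integrable \<mu> (\<lambda>x. C\<^sup>2 * (norm (g x))\<^sup>2)"
      using assms by (simp add: Lp_fun_2_iff)
    show "AE x in \<mu>. norm ((norm (f x))\<^sup>2) \<le> norm (C\<^sup>2 * (norm (g x))\<^sup>2)"
      using assms(3) by eventually_elim (simp add: power_mono flip: power_mult_distrib)
  qed (use assms in measurable)
  with assms show ?thesis by (simp add: Lp_fun_2_iff)
qed

lemma Lp_fun_2_add:
  assumes "f \<in> Lp_fun 2 \<mu>" "g \<in> Lp_fun 2 \<mu>"
  shows "(\<lambda>x. f x + g x) \<in> Lp_fun 2 \<mu>"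
proof -
  have meas: "f \<in> borel_measurable \<mu>" "g \<in> borel_measurable \<mu>"
    using assms by (simp_all add: Lp_fun_2_iff)
  have "integrable \<mu> (\<lambda>x. (norm (f x + g x))\<^sup>2)"
  proof (rule Bochner_Integration.integrable_bound)
    show "integrable \<mu> (\<lambda>x. 2 * (norm (f x))\<^sup>2 + 2 * (norm (g x))\<^sup>2)"
      using assms by (simp add: Lp_fun_2_iff)
    have "(norm (f x + g x))\<^sup>2 \<le> 2 * (norm (f x))\<^sup>2 + 2 * (norm (g x))\<^sup>2" for x
    proof -
      have "(norm (f x + g x))\<^sup>2 \<le> (norm (f x) + norm (g x))\<^sup>2"
        by (intro power_mono norm_triangle_ineq) auto
      also have "\<dots> \<le> 2 * (norm (f x))\<^sup>2 + 2 * (norm (g x))\<^sup>2"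
        using zero_le_power2[of "norm (f x) - norm (g x)"] by (simp add: power2_eq_square algebra_simps)
      finally show ?thesis .
    qed
    then show "AE x in \<mu>. norm ((norm (f x + g x))\<^sup>2) \<le> norm (2 * (norm (f x))\<^sup>2 + 2 * (norm (g x))\<^sup>2)"
      by (intro AE_I2) simp
  qed (use meas in measurable)
  with meas show ?thesis by (simp add: Lp_fun_2_iff)
qed

lemma Lp_fun_2_scaleR:
  assumes "f \<in> Lp_fun 2 \<mu>"
  shows "(\<lambda>x. c *\<^sub>R f x) \<in> Lp_fun 2 \<mu>"
  by (rule Lp_fun_2_dominated[OF _ assms, of _ "\<bar>c\<bar>"]) (use assms in \<open>auto simp: Lp_fun_2_iff\<close>)

lemma Lp_fun_2_diff:
  assumes "f \<in> Lp_fun 2 \<mu>" "g \<in> Lp_fun 2 \<mu>"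
  shows "(\<lambda>x. f x - g x) \<in> Lp_fun 2 \<mu>"
  using Lp_fun_2_add[OF assms(1) Lp_fun_2_scaleR[OF assms(2), of "-1"]] by simp

text \<open>
  A form of Young's inequality that replaces Hoelder's inequality below: squares are small where
  \<open>t \<le> \<tau>\<close> and dominated by the \<open>r\<close>-th power elsewhere.
\<close>

lemma square_le_powr:
  fixes t \<tau> r :: real
  assumes "0 \<le> t" "0 < \<tau>" "2 \<le> r"
  shows "t\<^sup>2 \<le> \<tau>\<^sup>2 + \<tau> powr (2 - r) * t powr r"
proof (cases "t \<le> \<tau>")
  case True
  then have "t\<^sup>2 \<le> \<tau>\<^sup>2"
    using assms by (intro power_mono)
  then show ?thesis by (simp add: add_increasing2)
next
  case False
  then have "t powr (2 - r) \<le> \<tau> powr (2 - r)"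
    using assms by (intro powr_mono2') auto
  then have "t powr (2 - r) * t powr r \<le> \<tau> powr (2 - r) * t powr r"
    by (intro mult_right_mono) auto
  moreover have "t powr (2 - r) * t powr r = t\<^sup>2"
    using False assms by (simp flip: powr_add)
  ultimately show ?thesis
    by (simp add: add_increasing)
qed

context finite_measure
begin

lemma Lp_fun_imp_Lp_fun_2:
  assumes "f \<in> Lp_fun r M" "r > 2"
  shows "f \<in> Lp_fun 2 M"
proof -
  have f: "f \<in> borel_measurable M" "integrable M (\<lambda>x. norm (f x) powr r)"
    using assms by (auto simp: Lp_fun_def)
  have "integrable M (\<lambda>x. (norm (f x))\<^sup>2)"
  proof (rule Bochner_Integration.integrable_bound)
    show "integrable M (\<lambda>x. 1 + norm (f x) powr r)"
      using f by simp
    show "AE x in M. norm ((norm (f x))\<^sup>2) \<le> norm (1 + norm (f x) powr r)"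
      using square_le_powr[of _ 1 r] assms by (intro AE_I2) auto
  qed (use f in measurable)
  with f show ?thesis by (simp add: Lp_fun_2_iff)
qed

text \<open>
  Choosing \<open>\<Lambda>\<close> first large and then the measure of \<open>E\<close> small makes the factor of \<open>N\<^sup>2\<close> as small as
  desired. This is where \<open>r > 2\<close> enters: the \<open>L\<^sup>2\<close> norm on small sets is of lower order than the
  \<open>L\<^sup>r\<close> norm (the norm gap required for semismoothness of superposition operators).
\<close>

lemma integral_square_on_set_le:
  assumes f: "f \<in> Lp_fun r M" and "r > 2" and E: "E \<in> sets M"
    and N: "0 < N" "Lp_norm r M f \<le> N" and "\<Lambda> > 0"
  shows "(\<integral>x. indicator E x * (norm (f x))\<^sup>2 \<partial>M) \<le> N\<^sup>2 * (\<Lambda>\<^sup>2 * measure M E + \<Lambda> powr (2 - r))"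
proof -
  define \<tau> where "\<tau> = N * \<Lambda>"
  have "\<tau> > 0"
    using N \<open>\<Lambda> > 0\<close> by (simp add: \<tau>_def)
  have intr: "integrable M (\<lambda>x. norm (f x) powr r)" and int2: "integrable M (\<lambda>x. (norm (f x))\<^sup>2)"
    using f Lp_fun_imp_Lp_fun_2[OF f \<open>r > 2\<close>] by (auto simp: Lp_fun_def)
  have "(\<integral>x. indicator E x * (norm (f x))\<^sup>2 \<partial>M)
      \<le> (\<integral>x. \<tau>\<^sup>2 * indicator E x + \<tau> powr (2 - r) * norm (f x) powr r \<partial>M)"
  proof (rule integral_mono)
    show "integrable M (\<lambda>x. indicator E x * (norm (f x))\<^sup>2)"
      using integrable_real_mult_indicator[OF E int2] by (simp add: mult.commute)
    show "integrable M (\<lambda>x. \<tau>\<^sup>2 * indicator E x + \<tau> powr (2 - r) * norm (f x) powr r)"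
      using intr E by (intro Bochner_Integration.integrable_add integrable_mult_right)
        (auto simp: emeasure_eq_measure)
    show "indicator E x * (norm (f x))\<^sup>2 \<le> \<tau>\<^sup>2 * indicator E x + \<tau> powr (2 - r) * norm (f x) powr r" for x
      using square_le_powr[of "norm (f x)" \<tau> r] \<open>\<tau> > 0\<close> \<open>r > 2\<close> by (auto simp: indicator_def)
  qed
  also have "\<dots> = \<tau>\<^sup>2 * measure M E + \<tau> powr (2 - r) * Lp_norm r M f powr r"
    using intr E \<open>r > 2\<close> by (subst Bochner_Integration.integral_add)
      (auto simp: emeasure_eq_measure Lp_norm_powr)
  also have "\<dots> \<le> \<tau>\<^sup>2 * measure M E + \<tau> powr (2 - r) * N powr r"
    using N \<open>r > 2\<close> by (intro add_mono mult_left_mono powr_mono2 Lp_norm_nonneg) auto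
  also have "\<tau> powr (2 - r) * N powr r = \<Lambda> powr (2 - r) * (N powr (2 - r) * N powr r)"
    using N \<open>\<Lambda> > 0\<close> by (simp add: \<tau>_def powr_mult)
  also have "N powr (2 - r) * N powr r = N\<^sup>2"
    using N by (simp flip: powr_add)
  finally show ?thesis
    by (simp add: \<tau>_def power_mult_distrib algebra_simps)
qed

lemma measure_norm_ge_le:
  assumes f: "f \<in> Lp_fun r M" and "r > 0" "c > 0" and N: "Lp_norm r M f \<le> N"
  shows "measure M {x \<in> space M. c \<le> norm (f x)} \<le> (N / c) powr r"
proof -
  have f': "f \<in> borel_measurable M" "integrable M (\<lambda>x. norm (f x) powr r)"
    using f by (auto simp: Lp_fun_def)
  have "c \<le> t \<longleftrightarrow> c powr r \<le> t powr r" if "0 \<le> t" for t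
    using that powr_mono2[of r c t] powr_less_mono2[of r t c] \<open>r > 0\<close> \<open>c > 0\<close> by linarith
  then have "{x \<in> space M. c \<le> norm (f x)} = {x \<in> space M. c powr r \<le> norm (f x) powr r}"
    by simp
  then have "measure M {x \<in> space M. c \<le> norm (f x)} \<le> (\<integral>x. norm (f x) powr r \<partial>M) / c powr r"
    using integral_Markov_inequality_measure[OF f'(2), of "{}" "c powr r"] \<open>c > 0\<close> by simp
  also have "\<dots> \<le> N powr r / c powr r"
    using assms by (simp flip: Lp_norm_powr add: divide_right_mono powr_mono2 Lp_norm_nonneg)
  also have "\<dots> = (N / c) powr r"
    using N Lp_norm_nonneg[of r M f] \<open>c > 0\<close> by (simp add: powr_divide)
  finally show ?thesis .
qed

lemma sets_not_isolating:
  fixes h :: "'b::euclidean_space \<Rightarrow> 'c::real_normed_vector"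
  assumes pa: "piecewise_affine \<Phi> h" and cont: "continuous_on UNIV h" and p: "p \<in> borel_measurable M"
  shows "{x \<in> space M. p x \<notin> isolating_points \<Phi> h \<epsilon>} \<in> sets M"
proof -
  have "p -` (- isolating_points \<Phi> h \<epsilon>) \<inter> space M \<in> sets M"
    using closed_isolating_points[OF pa cont] by (intro measurable_sets[OF p]) auto
  also have "p -` (- isolating_points \<Phi> h \<epsilon>) \<inter> space M = {x \<in> space M. p x \<notin> isolating_points \<Phi> h \<epsilon>}"
    by auto
  finally show ?thesis .
qed

lemma measure_not_isolating_small:
  fixes h :: "'b::euclidean_space \<Rightarrow> 'c::real_normed_vector"
  assumes pa: "piecewise_affine \<Phi> h" and cont: "continuous_on UNIV h"
    and p: "p \<in> borel_measurable M" and "\<eta> > 0"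
  obtains \<epsilon> where "\<epsilon> > 0" "measure M {x \<in> space M. p x \<notin> isolating_points \<Phi> h \<epsilon>} < \<eta>"
proof -
  define B where "B = (\<lambda>n. {x \<in> space M. p x \<notin> isolating_points \<Phi> h (1 / real (Suc n))})"
  have "B n \<in> sets M" for n
    unfolding B_def by (rule sets_not_isolating[OF pa cont p])
  moreover have "decseq B"
  proof (rule decseq_SucI)
    show "B (Suc n) \<subseteq> B n" for n
      using isolating_points_antimono[of "1 / real (Suc (Suc n))" "1 / real (Suc n)" \<Phi> h]
      by (auto simp: B_def frac_le)
  qed
  ultimately have "(\<lambda>n. measure M (B n)) \<longlonglongrightarrow> measure M (\<Inter>n. B n)"
    by (intro finite_Lim_measure_decseq) auto
  moreover have "(\<Inter>n. B n) = {}"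
    using UN_isolating_points[OF pa cont] by (auto simp: B_def)
  ultimately have "(\<lambda>n. measure M (B n)) \<longlonglongrightarrow> 0"
    by simp
  from order_tendstoD(2)[OF this \<open>\<eta> > 0\<close>] obtain n where "measure M (B n) < \<eta>"
    by (auto simp: eventually_sequentially)
  then show thesis
    by (intro that[of "1 / real (Suc n)"]) (simp_all add: B_def)
qed

text \<open>
  The linearization error vanishes wherever \<open>p x\<close> is isolating with radius \<open>\<rho>\<close> and \<open>\<bar>d x\<bar> < \<rho>\<close>, and
  it is at most \<open>2 L \<bar>d x\<bar>\<close> elsewhere. The exceptional set is small in measure: its first part by the
  choice of \<open>\<rho>\<close>, its second part by Markov's inequality once \<open>d\<close> is small in \<open>L\<^sup>r\<close>.
\<close>

lemma superposition_semismooth: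
  fixes h :: "real^'n \<Rightarrow> real^'m"
  assumes pa: "piecewise_affine \<Phi> h" and lip: "L-lipschitz_on UNIV h"
    and p: "p \<in> borel_measurable M" and "r > 2" and "\<epsilon> > 0"
  obtains \<delta> where "\<delta> > 0"
    and "\<And>d A N. d \<in> Lp_fun r M \<Longrightarrow> Lp_norm r M d \<le> N \<Longrightarrow> 0 < N \<Longrightarrow> N < \<delta> \<Longrightarrow>
      AE x in M. A x \<in> clarke_jacobian h (p x + d x) \<Longrightarrow> A \<in> borel_measurable M \<Longrightarrow>
      (\<integral>x. (norm (h (p x + d x) - h (p x) - A x *v d x))\<^sup>2 \<partial>M) \<le> \<epsilon> * N\<^sup>2"
proof -
  have "0 \<le> L" and cont: "continuous_on UNIV h"
    using lip by (auto simp: lipschitz_on_def lipschitz_on_continuous_on)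
  \<comment> \<open>one is added only to have \<open>C > 0\<close> when \<open>L = 0\<close>\<close>
  define C where "C = (2 * L)\<^sup>2 + 1"
  have "C > 0"
    by (simp add: C_def add_nonneg_pos)
  \<comment> \<open>\<open>\<Lambda>\<close>, \<open>\<eta>\<close> and \<open>\<delta>\<close> each allot one half: \<open>C \<Lambda> powr (2 - r) = \<epsilon> / 2\<close>, \<open>C \<Lambda>\<^sup>2 \<eta> = \<epsilon> / 2\<close>, and \<open>(\<delta> / \<rho>) powr r = \<eta> / 2\<close>\<close>
  define \<Lambda> where "\<Lambda> = (\<epsilon> / (2 * C)) powr (1 / (2 - r))"
  define \<eta> where "\<eta> = \<epsilon> / (2 * C * \<Lambda>\<^sup>2)"
  have "\<Lambda> > 0" and \<Lambda>: "\<Lambda> powr (2 - r) = \<epsilon> / (2 * C)"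
    using \<open>\<epsilon> > 0\<close> \<open>C > 0\<close> \<open>r > 2\<close> by (auto simp: \<Lambda>_def powr_powr)
  have "\<eta> > 0"
    using \<open>\<epsilon> > 0\<close> \<open>C > 0\<close> \<open>\<Lambda> > 0\<close> by (simp add: \<eta>_def)
  obtain \<rho> where "\<rho> > 0" and \<rho>: "measure M {x \<in> space M. p x \<notin> isolating_points \<Phi> h \<rho>} < \<eta> / 2"
    using measure_not_isolating_small[OF pa cont p, of "\<eta> / 2"] \<open>\<eta> > 0\<close> by auto
  define \<delta> where "\<delta> = \<rho> * (\<eta> / 2) powr (1 / r)"
  show thesis
  proof (rule that)
    show "\<delta> > 0"
      using \<open>\<rho> > 0\<close> \<open>\<eta> > 0\<close> by (simp add: \<delta>_def)
    fix d A N
    assume d: "d \<in> Lp_fun r M" "Lp_norm r M d \<le> N" and N: "0 < N" "N < \<delta>"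
      and A: "AE x in M. A x \<in> clarke_jacobian h (p x + d x)" and Am: "A \<in> borel_measurable M"
    have dm: "d \<in> borel_measurable M"
      using d by (simp add: Lp_fun_def)
    define B1 where "B1 = {x \<in> space M. p x \<notin> isolating_points \<Phi> h \<rho>}"
    define B2 where "B2 = {x \<in> space M. \<rho> \<le> norm (d x)}"
    define R where "R = (\<lambda>x. h (p x + d x) - h (p x) - A x *v d x)"
    have B: "B1 \<in> sets M" "B2 \<in> sets M"
      unfolding B1_def B2_def using dm by (auto intro: sets_not_isolating[OF pa cont p])
    have hm: "(\<lambda>x. h (f x)) \<in> borel_measurable M" if "f \<in> borel_measurable M" for f
      using measurable_compose[OF that borel_measurable_continuous_onI[OF cont]] .
    have Adm: "(\<lambda>x. A x *v d x) \<in> borel_measurable M"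
      by (rule borel_measurable_continuous_Pair[OF Am dm]) (intro bounded_bilinear.continuous_on[OF bounded_bilinear_matrix_vector_mult] continuous_intros)
    have Rm: "R \<in> borel_measurable M"
      unfolding R_def using p dm by (intro borel_measurable_diff hm Adm borel_measurable_add)
    have "measure M B2 \<le> (N / \<rho>) powr r"
      unfolding B2_def using d \<open>\<rho> > 0\<close> \<open>r > 2\<close> by (intro measure_norm_ge_le) auto
    also have "\<dots> \<le> ((\<eta> / 2) powr (1 / r)) powr r"
      using N \<open>\<rho> > 0\<close> \<open>r > 2\<close> by (intro powr_mono2) (auto simp: \<delta>_def field_simps)
    also have "\<dots> = \<eta> / 2"
      using \<open>r > 2\<close> \<open>\<eta> > 0\<close> by (simp add: powr_powr)
    finally have "measure M (B1 \<union> B2) \<le> \<eta>"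
      using measure_subadditive[OF B] \<rho> by (simp add: emeasure_eq_measure B1_def)
    have bound: "AE x in M. (norm (R x))\<^sup>2 \<le> C * (indicator (B1 \<union> B2) x * (norm (d x))\<^sup>2)"
      using A AE_space
    proof eventually_elim
      case (elim x)
      show ?case
      proof (cases "x \<in> B1 \<union> B2")
        case True
        have "norm (R x) \<le> norm (h (p x + d x) - h (p x)) + norm (A x *v d x)"
          unfolding R_def by (rule norm_triangle_ineq4)
        also have "\<dots> \<le> L * norm (d x) + L * norm (d x)"
          using lipschitz_onD[OF lip, of "p x + d x" "p x"]
          by (intro add_mono clarke_jacobian_norm_bound[OF lip elim(1)]) (simp add: dist_norm)
        finally have "(norm (R x))\<^sup>2 \<le> (2 * L * norm (d x))\<^sup>2"
          by (intro power_mono) auto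
        also have "\<dots> \<le> C * (norm (d x))\<^sup>2"
          by (simp add: C_def power_mult_distrib algebra_simps)
        finally show ?thesis
          using True by simp
      next
        case False
        then have "h (p x + d x) - h (p x) = A x *v ((p x + d x) - p x)"
          using elim by (intro clarke_jacobian_exact[OF pa cont]) (auto simp: B1_def B2_def dist_norm)
        then show ?thesis
          using False by (simp add: R_def)
      qed
    qed
    have int: "integrable M (\<lambda>x. indicator (B1 \<union> B2) x * (norm (d x))\<^sup>2)"
      using integrable_real_mult_indicator[of "B1 \<union> B2" M "\<lambda>x. (norm (d x))\<^sup>2"] B
        Lp_fun_imp_Lp_fun_2[OF d(1) \<open>r > 2\<close>] by (simp add: mult.commute Lp_fun_2_iff)
    have "(\<integral>x. (norm (R x))\<^sup>2 \<partial>M) \<le> (\<integral>x. C * (indicator (B1 \<union> B2) x * (norm (d x))\<^sup>2) \<partial>M)"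
    proof (rule integral_mono_AE)
      show "integrable M (\<lambda>x. (norm (R x))\<^sup>2)"
      proof (rule Bochner_Integration.integrable_bound)
        show "integrable M (\<lambda>x. C * (indicator (B1 \<union> B2) x * (norm (d x))\<^sup>2))"
          by (intro integrable_mult_right int)
        show "(\<lambda>x. (norm (R x))\<^sup>2) \<in> borel_measurable M"
          using Rm by measurable
        show "AE x in M. norm ((norm (R x))\<^sup>2) \<le> norm (C * (indicator (B1 \<union> B2) x * (norm (d x))\<^sup>2))"
          using bound by eventually_elim (use \<open>C > 0\<close> in \<open>simp add: abs_mult\<close>)
      qed
    qed (use int bound in \<open>simp_all\<close>)
    also have "\<dots> \<le> C * (N\<^sup>2 * (\<Lambda>\<^sup>2 * measure M (B1 \<union> B2) + \<Lambda> powr (2 - r)))"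
      using \<open>C > 0\<close> B d N \<open>\<Lambda> > 0\<close> \<open>r > 2\<close>
      unfolding integral_mult_right_zero by (intro mult_left_mono integral_square_on_set_le) auto
    also have "\<dots> \<le> C * (N\<^sup>2 * (\<Lambda>\<^sup>2 * \<eta> + \<Lambda> powr (2 - r)))"
      using \<open>C > 0\<close> \<open>measure M (B1 \<union> B2) \<le> \<eta>\<close> by (intro mult_left_mono add_right_mono) auto
    also have "\<dots> = \<epsilon> * N\<^sup>2"
      using \<open>C > 0\<close> \<open>\<Lambda> > 0\<close> by (simp add: \<Lambda> \<eta>_def field_simps)
    finally show "(\<integral>x. (norm (h (p x + d x) - h (p x) - A x *v d x))\<^sup>2 \<partial>M) \<le> \<epsilon> * N\<^sup>2"
      by (simp add: R_def)
  qed
qed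

end

section \<open>The Newton iteration\<close>

text \<open>
  The Lax--Milgram theorem, with coercivity constant 1. The damped residual map
  \<open>y \<mapsto> y - \<tau> (B y - f)\<close> is a contraction: expanding the square gives, for squared
  distances, the factor \<open>1 - 2 \<tau> + \<tau>\<^sup>2 C\<^sup>2\<close>, which is \<open>1 - \<tau>\<close> for \<open>\<tau> = 1 / C\<^sup>2\<close>.
\<close>

lemma coercive_imp_bijective:
  fixes B :: "'y::{real_inner,complete_space} \<Rightarrow> 'y"
  assumes B: "bounded_linear B" and coercive: "\<And>y. (norm y)\<^sup>2 \<le> B y \<bullet> y"
  shows "\<exists>!y. B y = f"
proof -
  interpret B: bounded_linear B by fact
  obtain K where "K > 0" and K: "\<And>y. norm (B y) \<le> norm y * K"
    using B.pos_bounded by blast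
  \<comment> \<open>the bound is enlarged to at least 1, so that \<open>\<tau> \<le> 1\<close> and the contraction factor makes sense\<close>
  define C where "C = max 1 K"
  have "C \<ge> 1" and C: "norm (B y) \<le> C * norm y" for y
  proof -
    have "norm y * K \<le> C * norm y"
      by (simp add: C_def mult.commute[of "norm y"] mult_right_mono)
    with K show "norm (B y) \<le> C * norm y"
      by (rule order_trans)
  qed (simp add: C_def)
  define \<tau> where "\<tau> = 1 / C\<^sup>2"
  have "\<tau> > 0" and "\<tau> \<le> 1" and \<tau>: "\<tau> * C\<^sup>2 = 1"
    using \<open>C \<ge> 1\<close> by (auto simp: \<tau>_def)
  define \<Psi> where "\<Psi> = (\<lambda>y. y - \<tau> *\<^sub>R (B y - f))"
  have "dist (\<Psi> x) (\<Psi> y) \<le> sqrt (1 - \<tau>) * dist x y" for x y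
  proof -
    define e where "e = x - y"
    have "\<Psi> x - \<Psi> y = e - \<tau> *\<^sub>R B e"
      by (simp add: \<Psi>_def e_def B.diff algebra_simps)
    then have "(dist (\<Psi> x) (\<Psi> y))\<^sup>2 = (norm (e - \<tau> *\<^sub>R B e))\<^sup>2"
      by (simp add: dist_norm)
    also have "\<dots> = (norm e)\<^sup>2 - 2 * \<tau> * (B e \<bullet> e) + \<tau>\<^sup>2 * (norm (B e))\<^sup>2"
      unfolding power2_norm_eq_inner by (simp add: inner_commute algebra_simps power2_eq_square)
    also have "\<dots> \<le> (norm e)\<^sup>2 - 2 * \<tau> * (norm e)\<^sup>2 + \<tau>\<^sup>2 * (C * norm e)\<^sup>2"
      using coercive[of e] C[of e] \<open>\<tau> > 0\<close>
      by (intro add_mono diff_mono mult_left_mono power_mono) auto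
    also have "\<tau>\<^sup>2 * (C * norm e)\<^sup>2 = \<tau> * (norm e)\<^sup>2"
    proof -
      have "\<tau>\<^sup>2 * (C * norm e)\<^sup>2 = \<tau> * (\<tau> * C\<^sup>2) * (norm e)\<^sup>2"
        by (simp add: power2_eq_square)
      then show ?thesis by (simp add: \<tau>)
    qed
    finally have "(dist (\<Psi> x) (\<Psi> y))\<^sup>2 \<le> (1 - \<tau>) * (dist x y)\<^sup>2"
      by (simp add: e_def dist_norm algebra_simps)
    also have "\<dots> = (sqrt (1 - \<tau>) * dist x y)\<^sup>2"
      using \<open>\<tau> \<le> 1\<close> by (simp add: power_mult_distrib)
    finally show ?thesis
      by (rule power2_le_imp_le) (use \<open>\<tau> \<le> 1\<close> in auto)
  qed
  then have "\<exists>!y. \<Psi> y = y"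
    using \<open>\<tau> > 0\<close> \<open>\<tau> \<le> 1\<close> by (intro banach_fix_type[of "sqrt (1 - \<tau>)"]) auto
  moreover have "\<Psi> y = y \<longleftrightarrow> B y = f" for y
    using \<open>\<tau> > 0\<close> by (auto simp: \<Psi>_def)
  ultimately show ?thesis by simp
qed

text \<open>
  An estimate \<open>o(\<bar>w - ws\<bar>)\<close> for the error after one step is all that local superlinear convergence
  needs: on a ball where the error is at least halved, the iterates stay and converge.
\<close>

lemma superlinear_convergence:
  fixes step :: "'a::real_normed_vector \<Rightarrow> 'a \<Rightarrow> bool" and ws :: 'a
  assumes solvable: "\<And>w. \<exists>!\<delta>. step w \<delta>"
    and est: "\<And>\<epsilon>. \<epsilon> > 0 \<Longrightarrow> \<exists>\<eta>>0. \<forall>w \<delta>. norm (w - ws) < \<eta> \<longrightarrow> step w \<delta> \<longrightarrow>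
      norm (w + \<delta> - ws) \<le> \<epsilon> * norm (w - ws)"
  defines "iter \<equiv> \<lambda>w0 (w :: nat \<Rightarrow> 'a). w 0 = w0 \<and> (\<forall>k. \<exists>\<delta>. step (w k) \<delta> \<and> w (Suc k) = w k + \<delta>)"
  shows "\<exists>N. open N \<and> ws \<in> N \<and> (\<forall>w0\<in>N. (\<exists>!w. iter w0 w) \<and>
    (\<forall>w. iter w0 w \<longrightarrow> w \<longlonglongrightarrow> ws \<and>
      (\<lambda>k. norm (w (Suc k) - ws)) \<in> o(\<lambda>k. norm (w k - ws))))"
proof -
  define G where "G = (\<lambda>w. w + (THE \<delta>. step w \<delta>))"
  have G: "(\<exists>\<delta>. step w \<delta> \<and> v = w + \<delta>) \<longleftrightarrow> v = G w" for w v
    using theI'[OF solvable[of w]] solvable[of w] unfolding G_def by metis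
  have iter: "iter w0 w \<longleftrightarrow> w = (\<lambda>k. (G ^^ k) w0)" for w0 w
  proof
    assume w: "iter w0 w"
    have "w k = (G ^^ k) w0" for k
      by (induction k) (use w in \<open>simp_all add: iter_def G\<close>)
    then show "w = (\<lambda>k. (G ^^ k) w0)" by auto
  qed (simp add: iter_def G)
  have Gest: "\<exists>\<eta>>0. \<forall>w. norm (w - ws) < \<eta> \<longrightarrow> norm (G w - ws) \<le> \<epsilon> * norm (w - ws)" if "\<epsilon> > 0" for \<epsilon>
    using est[OF that] G by metis
  obtain \<eta> where "\<eta> > 0" and \<eta>: "\<And>w. norm (w - ws) < \<eta> \<Longrightarrow> norm (G w - ws) \<le> 1 / 2 * norm (w - ws)"
    using Gest[of "1 / 2"] by auto
  show ?thesis
  proof (intro exI[of _ "ball ws \<eta>"] conjI ballI allI impI)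
    show "\<exists>!w. iter w0 w" for w0
      by (simp add: iter)
    fix w0 w assume "w0 \<in> ball ws \<eta>" and "iter w0 w"
    then have w0: "norm (w0 - ws) < \<eta>" and w: "w = (\<lambda>k. (G ^^ k) w0)"
      by (simp_all add: iter dist_norm norm_minus_commute)
    have geom: "norm (w k - ws) \<le> (1 / 2) ^ k * norm (w0 - ws)" for k
    proof (induction k)
      case (Suc k)
      have "(1 / 2) ^ k * norm (w0 - ws) \<le> 1 * norm (w0 - ws)"
        by (intro mult_right_mono power_le_one) auto
      with Suc w0 have "norm (w k - ws) < \<eta>" by simp
      from \<eta>[OF this] Suc show ?case by (simp add: w)
    qed (simp add: w)
    have "(\<lambda>k. (1 / 2) ^ k * norm (w0 - ws)) \<longlonglongrightarrow> 0 * norm (w0 - ws)"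
      by (intro tendsto_intros LIMSEQ_realpow_zero) auto
    then have "(\<lambda>k. w k - ws) \<longlonglongrightarrow> 0"
      by (intro Lim_null_comparison[OF always_eventually, of "\<lambda>k. w k - ws"]) (use geom in auto)
    then show lim: "w \<longlonglongrightarrow> ws"
      by (rule LIM_zero_cancel)
    show "(\<lambda>k. norm (w (Suc k) - ws)) \<in> o(\<lambda>k. norm (w k - ws))"
    proof (rule landau_o.smallI)
      fix c :: real assume "c > 0"
      then obtain \<kappa> where "\<kappa> > 0" and \<kappa>: "\<And>w. norm (w - ws) < \<kappa> \<Longrightarrow> norm (G w - ws) \<le> c * norm (w - ws)"
        using Gest by blast
      have "\<forall>\<^sub>F k in sequentially. norm (w k - ws) < \<kappa>"
        using tendstoD[OF lim \<open>\<kappa> > 0\<close>] by (simp add: dist_norm)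
      then show "\<forall>\<^sub>F k in sequentially. norm (norm (w (Suc k) - ws)) \<le> c * norm (norm (w k - ws))"
        by eventually_elim (use \<kappa> in \<open>simp add: w\<close>)
    qed
  qed (use \<open>\<eta> > 0\<close> in auto)
qed

text \<open>
  What the convergence proof uses of the regularized map \<open>h\<close>: it is a continuous selection of
  finitely many affine maps, Lipschitz continuous, and monotone.
\<close>

locale semismooth_newton = finite_measure \<mu>
  for \<mu> :: "(real^'d) measure"
    and S :: "(real^'d \<Rightarrow> real^2) \<Rightarrow> 'y::{real_inner,complete_space}"
    and T :: "'y \<Rightarrow> 'v::banach"
    and j :: "'v \<Rightarrow> real^'d \<Rightarrow> real^2"
    and h :: "real^2 \<Rightarrow> real^2" and \<Phi> :: "(real^2 \<Rightarrow> real^2) set"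
    and M :: "'v \<Rightarrow> real^'d \<Rightarrow> real^2^2"
    and r L :: real +
  assumes S: "bounded_linear_L2 \<mu> S"
    and r: "r > 2" and j: "Lp_embedding r \<mu> j"
    and T: "bounded_linear T" and adj: "is_adjoint_L2 \<mu> S (\<lambda>y. j (T y))"
    and sel: "newton_selection \<mu> h j M"
    and pa: "piecewise_affine \<Phi> h" and lip: "L-lipschitz_on UNIV h"
    and mono: "\<And>p q. 0 \<le> (h p - h q) \<bullet> (p - q)"
begin

text \<open>
  The operator \<open>S D\<^sub>N H(p)\<close> of the linearized state equation.
\<close>

definition SDH :: "'v \<Rightarrow> 'v \<Rightarrow> 'y" where
  "SDH p v = S (\<lambda>x. M p x *v j v x)"

lemma S_add: "u \<in> Lp_fun 2 \<mu> \<Longrightarrow> v \<in> Lp_fun 2 \<mu> \<Longrightarrow> S (\<lambda>x. u x + v x) = S u + S v"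
  and S_scaleR: "u \<in> Lp_fun 2 \<mu> \<Longrightarrow> S (\<lambda>x. c *\<^sub>R u x) = c *\<^sub>R S u"
  using S by (simp_all add: bounded_linear_L2_def)

lemma S_diff:
  assumes "u \<in> Lp_fun 2 \<mu>" "v \<in> Lp_fun 2 \<mu>"
  shows "S (\<lambda>x. u x - v x) = S u - S v"
  using S_add[OF assms(1) Lp_fun_2_scaleR[OF assms(2), of "-1"]] S_scaleR[OF assms(2), of "-1"] by simp

lemma S_bound:
  obtains K where "K > 0" "\<And>u. u \<in> Lp_fun 2 \<mu> \<Longrightarrow> norm (S u) \<le> K * Lp_norm 2 \<mu> u"
proof -
  obtain K where K: "\<And>u. u \<in> Lp_fun 2 \<mu> \<Longrightarrow> norm (S u) \<le> K * Lp_norm 2 \<mu> u"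
    using S unfolding bounded_linear_L2_def by blast
  show thesis
  proof (rule that)
    show "max 1 K > 0" by simp
    show "norm (S u) \<le> max 1 K * Lp_norm 2 \<mu> u" if "u \<in> Lp_fun 2 \<mu>" for u
      using K[OF that] by (rule order_trans) (intro mult_right_mono Lp_norm_nonneg, simp)
  qed
qed

lemma j_bound:
  obtains K where "K > 0" "\<And>v. Lp_norm r \<mu> (j v) \<le> K * norm v"
proof -
  obtain K where K: "\<And>v. Lp_norm r \<mu> (j v) \<le> K * norm v"
    using j by (auto simp: Lp_embedding_def)
  show thesis
  proof (rule that)
    show "max 1 K > 0" by simp
    show "Lp_norm r \<mu> (j v) \<le> max 1 K * norm v" for v
      using K by (rule order_trans) (intro mult_right_mono, auto)
  qed
qed

lemma j_Lr: "j v \<in> Lp_fun r \<mu>"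
  using j by (simp add: Lp_embedding_def)

lemma j_L2: "j v \<in> Lp_fun 2 \<mu>"
  by (rule Lp_fun_imp_Lp_fun_2[OF j_Lr r])

lemma j_measurable: "j v \<in> borel_measurable \<mu>"
  using j_Lr by (simp add: Lp_fun_def)

lemma j_add: "AE x in \<mu>. j (v + w) x = j v x + j w x"
  and j_scaleR: "AE x in \<mu>. j (c *\<^sub>R v) x = c *\<^sub>R j v x"
  using j by (simp_all add: Lp_embedding_def)

lemma j_diff: "AE x in \<mu>. j (v - w) x = j v x - j w x"
proof -
  have "AE x in \<mu>. j (v + (-1) *\<^sub>R w) x = j v x + (-1) *\<^sub>R j w x"
    using j_add[of v "(-1) *\<^sub>R w"] j_scaleR[of "-1" w] by eventually_elim simp
  then show ?thesis by simp
qed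

lemma M_measurable: "M p \<in> borel_measurable \<mu>"
  and M_clarke: "AE x in \<mu>. M p x \<in> clarke_jacobian h (j p x)"
  using sel by (simp_all add: newton_selection_def)

lemma matrix_field_L2:
  assumes "f \<in> Lp_fun 2 \<mu>"
  shows "(\<lambda>x. M p x *v f x) \<in> Lp_fun 2 \<mu>"
proof (rule Lp_fun_2_dominated[OF _ assms])
  have "f \<in> borel_measurable \<mu>"
    using assms by (simp add: Lp_fun_2_iff)
  then show "(\<lambda>x. M p x *v f x) \<in> borel_measurable \<mu>"
    by (rule borel_measurable_continuous_Pair[OF M_measurable])
      (intro bounded_bilinear.continuous_on[OF bounded_bilinear_matrix_vector_mult] continuous_intros)
  show "AE x in \<mu>. norm (M p x *v f x) \<le> L * norm (f x)"
    using M_clarke by eventually_elim (rule clarke_jacobian_norm_bound[OF lip])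
qed

lemma superposition_L2:
  assumes "f \<in> Lp_fun 2 \<mu>"
  shows "(\<lambda>x. h (f x)) \<in> Lp_fun 2 \<mu>"
proof -
  have cont: "continuous_on UNIV h"
    using lip by (rule lipschitz_on_continuous_on)
  have f: "f \<in> borel_measurable \<mu>"
    using assms by (simp add: Lp_fun_2_iff)
  have hf: "(\<lambda>x. h (f x)) \<in> borel_measurable \<mu>"
    using measurable_compose[OF f borel_measurable_continuous_onI[OF cont]] .
  have "(\<lambda>x. h (f x) - h 0) \<in> Lp_fun 2 \<mu>"
  proof (rule Lp_fun_2_dominated[OF _ assms])
    show "(\<lambda>x. h (f x) - h 0) \<in> borel_measurable \<mu>"
      using hf by measurable
    show "AE x in \<mu>. norm (h (f x) - h 0) \<le> L * norm (f x)"
      using lipschitz_onD[OF lip, of _ 0] by (intro AE_I2) (simp add: dist_norm)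
  qed
  moreover have "(\<lambda>x. h 0) \<in> Lp_fun 2 \<mu>"
    by (simp add: Lp_fun_2_iff)
  ultimately have "(\<lambda>x. (h (f x) - h 0) + h 0) \<in> Lp_fun 2 \<mu>"
    by (rule Lp_fun_2_add)
  then show ?thesis by simp
qed

lemma SDH_add: "SDH p (v + w) = SDH p v + SDH p w"
proof -
  have "SDH p (v + w) = S (\<lambda>x. M p x *v j v x + M p x *v j w x)"
    unfolding SDH_def
  proof (rule bounded_linear_L2_cong_AE[OF S])
    show "AE x in \<mu>. M p x *v j (v + w) x = M p x *v j v x + M p x *v j w x"
      using j_add[of v w] by eventually_elim (simp add: matrix_vector_right_distrib)
  qed (intro matrix_field_L2 Lp_fun_2_add j_L2)+
  also have "\<dots> = SDH p v + SDH p w"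
    unfolding SDH_def by (intro S_add matrix_field_L2 j_L2)
  finally show ?thesis .
qed

lemma SDH_scaleR: "SDH p (c *\<^sub>R v) = c *\<^sub>R SDH p v"
proof -
  have "SDH p (c *\<^sub>R v) = S (\<lambda>x. c *\<^sub>R (M p x *v j v x))"
    unfolding SDH_def
  proof (rule bounded_linear_L2_cong_AE[OF S])
    show "AE x in \<mu>. M p x *v j (c *\<^sub>R v) x = c *\<^sub>R (M p x *v j v x)"
      using j_scaleR[of c v] by eventually_elim (simp add: matrix_vector_mult_scaleR)
  qed (intro matrix_field_L2 Lp_fun_2_scaleR j_L2)+
  also have "\<dots> = c *\<^sub>R SDH p v"
    unfolding SDH_def by (intro S_scaleR matrix_field_L2 j_L2)
  finally show ?thesis .
qed

lemma bounded_linear_SDH: "bounded_linear (SDH p)"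
proof -
  obtain Ks where "Ks > 0" and Ks: "\<And>u. u \<in> Lp_fun 2 \<mu> \<Longrightarrow> norm (S u) \<le> Ks * Lp_norm 2 \<mu> u"
    using S_bound by blast
  obtain Kj where "Kj > 0" and Kj: "\<And>v. Lp_norm r \<mu> (j v) \<le> Kj * norm v"
    using j_bound by blast
  \<comment> \<open>\<open>c N\<^sup>2\<close> bounds the square integral: this is \<open>integral_square_on_set_le\<close> on the whole space with \<open>\<Lambda> = 1\<close>\<close>
  define c where "c = L\<^sup>2 * (measure \<mu> (space \<mu>) + 1)"
  have "c \<ge> 0"
    by (simp add: c_def)
  have "norm (SDH p v) \<le> norm v * (Ks * sqrt c * Kj)" for v
  proof (cases "v = 0")
    case True
    then show ?thesis
      using SDH_scaleR[of p 0 v] by simp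
  next
    case False
    define N where "N = Kj * norm v"
    have "N > 0"
      using False \<open>Kj > 0\<close> by (simp add: N_def)
    have Mj: "(\<lambda>x. M p x *v j v x) \<in> Lp_fun 2 \<mu>"
      by (intro matrix_field_L2 j_L2)
    have "(Lp_norm 2 \<mu> (\<lambda>x. M p x *v j v x))\<^sup>2 = (\<integral>x. (norm (M p x *v j v x))\<^sup>2 \<partial>\<mu>)"
      by (rule Lp_norm_2_squared)
    also have "\<dots> \<le> (\<integral>x. L\<^sup>2 * (norm (j v x))\<^sup>2 \<partial>\<mu>)"
    proof (rule integral_mono_AE)
      show "AE x in \<mu>. (norm (M p x *v j v x))\<^sup>2 \<le> L\<^sup>2 * (norm (j v x))\<^sup>2"
        using M_clarke[of p]
      proof eventually_elim
        case (elim x)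
        have "(norm (M p x *v j v x))\<^sup>2 \<le> (L * norm (j v x))\<^sup>2"
          by (intro power_mono clarke_jacobian_norm_bound[OF lip elim]) auto
        then show ?case by (simp add: power_mult_distrib)
      qed
    qed (use Mj j_L2[of v] in \<open>simp_all add: Lp_fun_2_iff\<close>)
    also have "\<dots> = L\<^sup>2 * (\<integral>x. indicator (space \<mu>) x * (norm (j v x))\<^sup>2 \<partial>\<mu>)"
      unfolding integral_mult_right_zero
      by (rule arg_cong, rule Bochner_Integration.integral_cong) simp_all
    also have "\<dots> \<le> L\<^sup>2 * (N\<^sup>2 * (1\<^sup>2 * measure \<mu> (space \<mu>) + 1 powr (2 - r)))"
      using Kj \<open>N > 0\<close> by (intro mult_left_mono integral_square_on_set_le j_Lr r) (auto simp: N_def)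
    also have "\<dots> = (sqrt c * N)\<^sup>2"
      using \<open>c \<ge> 0\<close> by (simp add: c_def power_mult_distrib)
    finally have "Lp_norm 2 \<mu> (\<lambda>x. M p x *v j v x) \<le> sqrt c * N"
      by (rule power2_le_imp_le) (use \<open>c \<ge> 0\<close> \<open>N > 0\<close> in auto)
    then have "Ks * Lp_norm 2 \<mu> (\<lambda>x. M p x *v j v x) \<le> Ks * (sqrt c * N)"
      using \<open>Ks > 0\<close> by (intro mult_left_mono) auto
    with Ks[OF Mj] have "norm (SDH p v) \<le> Ks * (sqrt c * N)"
      unfolding SDH_def by (rule order_trans)
    then show ?thesis
      by (simp add: N_def mult_ac)
  qed
  then show ?thesis
    by (rule bounded_linear_intro[OF SDH_add SDH_scaleR])
qed

text \<open>
  The reason for which all Newton systems are solvable with a uniform bound: by the adjoint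
  relation the quadratic form of \<open>S D\<^sub>N H(p) S\<^sup>*\<close> is the integral of the quadratic forms of Clarke
  Jacobians of a monotone map.
\<close>

lemma SDH_adjoint_nonneg: "0 \<le> SDH p (T e) \<bullet> e"
proof -
  have "SDH p (T e) \<bullet> e = (\<integral>x. (M p x *v j (T e) x) \<bullet> j (T e) x \<partial>\<mu>)"
    unfolding SDH_def using adj matrix_field_L2[OF j_L2] by (simp add: is_adjoint_L2_def)
  also have "\<dots> \<ge> 0"
  proof (rule integral_nonneg_AE)
    show "AE x in \<mu>. 0 \<le> (M p x *v j (T e) x) \<bullet> j (T e) x"
      using M_clarke[of p] by eventually_elim (rule clarke_jacobian_monotone[OF mono])
  qed
  finally show ?thesis .
qed

text \<open>
  Elimination of \<open>\<delta>p\<close> by the adjoint equation leaves an equation in the Hilbert space alone, with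
  the operator \<open>I + S D\<^sub>N H(p) S\<^sup>*\<close>.
\<close>

lemma newton_step_iff:
  "newton_step S T z h j M (y, p) (\<delta>y, \<delta>p) \<longleftrightarrow>
     \<delta>p = - p - T (y - z) - T \<delta>y \<and>
     \<delta>y + SDH p (T \<delta>y) = - y + S (\<lambda>x. h (j p x)) + SDH p (- p - T (y - z))"
proof -
  interpret A: bounded_linear "SDH p"
    by (rule bounded_linear_SDH)
  have "\<delta>y - SDH p \<delta>p = f \<longleftrightarrow> \<delta>y + SDH p (T \<delta>y) = f + SDH p (- p - T (y - z))"
    if "\<delta>p = - p - T (y - z) - T \<delta>y" for f
    unfolding that A.diff[of "- p - T (y - z)"] by (auto simp: algebra_simps)
  then show ?thesis
    unfolding newton_step_def prod.case SDH_def[symmetric] eq_diff_eq[of \<delta>p] by blast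
qed

lemma newton_step_solvable: "\<exists>!\<delta>. newton_step S T z h j M w \<delta>"
proof (cases w)
  case (Pair y p)
  interpret A: bounded_linear "SDH p"
    by (rule bounded_linear_SDH)
  interpret T: bounded_linear T
    by (rule T)
  have "\<exists>!\<delta>y. \<delta>y + SDH p (T \<delta>y) = - y + S (\<lambda>x. h (j p x)) + SDH p (- p - T (y - z))"
  proof (rule coercive_imp_bijective)
    show "bounded_linear (\<lambda>\<delta>y. \<delta>y + SDH p (T \<delta>y))"
      by (intro bounded_linear_add bounded_linear_ident bounded_linear_compose[OF bounded_linear_SDH T])
    show "(norm e)\<^sup>2 \<le> (e + SDH p (T e)) \<bullet> e" for e
      using SDH_adjoint_nonneg[of p e] by (simp add: power2_norm_eq_inner inner_add_left)
  qed
  then obtain d where d: "\<And>\<delta>y. \<delta>y + SDH p (T \<delta>y) = - y + S (\<lambda>x. h (j p x)) + SDH p (- p - T (y - z)) \<longleftrightarrow> \<delta>y = d"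
    by metis
  show ?thesis
  proof (rule ex1I)
    show "newton_step S T z h j M w (d, - p - T (y - z) - T d)"
      by (simp only: Pair newton_step_iff d)
    show "\<delta> = (d, - p - T (y - z) - T d)" if "newton_step S T z h j M w \<delta>" for \<delta>
      using that by (cases \<delta>) (simp only: Pair newton_step_iff d)
  qed
qed

text \<open>
  The new error \<open>e\<close> in the state solves \<open>e + S D\<^sub>N H(p) S\<^sup>* e = S R\<close>, where \<open>R\<close> is the linearization
  error of the superposition operator at \<open>p\<close>. Testing with \<open>e\<close> gives \<open>\<bar>e\<bar> \<le> \<bar>S R\<bar>\<close> with constant 1,
  independently of \<open>p\<close>, and the adjoint equation turns \<open>e\<close> into the error of the adjoint state.
\<close>

lemma newton_step_error:
  assumes sol: "solves_system S T z h j (ys, ps)"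
    and step: "newton_step S T z h j M (y, p) (\<delta>y, \<delta>p)"
  shows "norm ((y, p) + (\<delta>y, \<delta>p) - (ys, ps)) \<le> (1 + onorm T) *
    norm (S (\<lambda>x. h (j p x) - h (j ps x) - M p x *v (j p x - j ps x)))"
proof -
  interpret A: bounded_linear "SDH p"
    by (rule bounded_linear_SDH)
  interpret T: bounded_linear T
    by (rule T)
  define e where "e = y + \<delta>y - ys"
  have p': "p + \<delta>p - ps = - T e"
  proof -
    have dp: "\<delta>p = - p - T (y - z) - T \<delta>y"
      using step by (simp only: newton_step_iff)
    have ps: "ps = - T (ys - z)"
      using sol unfolding solves_system_def by blast
    show ?thesis
      unfolding dp ps e_def T.add T.diff by simp
  qed
  have hj: "(\<lambda>x. h (j v x)) \<in> Lp_fun 2 \<mu>" for v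
    by (intro superposition_L2 j_L2)
  have Mj: "(\<lambda>x. M p x *v (j p x - j ps x)) \<in> Lp_fun 2 \<mu>"
    by (intro matrix_field_L2 Lp_fun_2_diff j_L2)
  define \<rho> where "\<rho> = S (\<lambda>x. h (j p x) - h (j ps x) - M p x *v (j p x - j ps x))"
  have "\<rho> = S (\<lambda>x. h (j p x)) - S (\<lambda>x. h (j ps x)) - S (\<lambda>x. M p x *v (j p x - j ps x))"
    unfolding \<rho>_def
    unfolding S_diff[OF Lp_fun_2_diff[OF hj hj] Mj] S_diff[OF hj hj] ..
  also have "S (\<lambda>x. M p x *v (j p x - j ps x)) = SDH p (p - ps)"
    unfolding SDH_def
  proof (rule bounded_linear_L2_cong_AE[OF S])
    show "AE x in \<mu>. M p x *v (j p x - j ps x) = M p x *v j (p - ps) x"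
      using j_diff[of p ps] by eventually_elim simp
  qed (intro matrix_field_L2 Lp_fun_2_diff j_L2)+
  also have "S (\<lambda>x. h (j ps x)) = ys"
    using sol unfolding solves_system_def prod.case by metis
  finally have \<rho>: "\<rho> = S (\<lambda>x. h (j p x)) - ys - SDH p (p - ps)" .
  have "\<delta>y - SDH p \<delta>p = - y + S (\<lambda>x. h (j p x))"
    using step by (simp add: newton_step_def SDH_def)
  then have e: "e = S (\<lambda>x. h (j p x)) + SDH p \<delta>p - ys"
    by (simp add: e_def algebra_simps)
  have SDH_\<delta>p: "SDH p \<delta>p = - SDH p (T e) - SDH p (p - ps)"
  proof -
    have "\<delta>p = - T e - (p - ps)"
      using p' by (simp add: algebra_simps)
    then show ?thesis
      by (simp only: A.diff A.neg)
  qed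
  have "e + SDH p (T e) = S (\<lambda>x. h (j p x)) + SDH p \<delta>p - ys + SDH p (T e)"
    using e by (rule arg_cong)
  also have "\<dots> = \<rho>"
    unfolding SDH_\<delta>p \<rho> by simp
  finally have "e + SDH p (T e) = \<rho>" .
  then have "\<rho> \<bullet> e = norm e * norm e + SDH p (T e) \<bullet> e"
    by (metis inner_add_left power2_norm_eq_inner power2_eq_square)
  then have "norm e * norm e \<le> \<rho> \<bullet> e"
    using SDH_adjoint_nonneg[of p e] by linarith
  also have "\<dots> \<le> norm \<rho> * norm e"
    by (rule norm_cauchy_schwarz)
  finally have "norm e \<le> norm \<rho>"
    by (cases "e = 0") auto
  have "norm ((y, p) + (\<delta>y, \<delta>p) - (ys, ps)) = norm (e, - T e)"
    by (simp add: p' e_def[symmetric])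
  also have "\<dots> \<le> norm e + norm (T e)"
    using norm_Pair_le[of e "- T e"] by simp
  also have "\<dots> \<le> (1 + onorm T) * norm e"
    using onorm[OF T, of e] by (simp add: algebra_simps)
  also have "\<dots> \<le> (1 + onorm T) * norm \<rho>"
    using \<open>norm e \<le> norm \<rho>\<close> onorm_pos_le[OF T] by (intro mult_left_mono) auto
  finally show ?thesis
    unfolding \<rho>_def .
qed

lemma newton_step_superlinear:
  assumes sol: "solves_system S T z h j ws" and "\<epsilon> > 0"
  shows "\<exists>\<eta>>0. \<forall>w \<delta>. norm (w - ws) < \<eta> \<longrightarrow> newton_step S T z h j M w \<delta> \<longrightarrow>
    norm (w + \<delta> - ws) \<le> \<epsilon> * norm (w - ws)"
proof -
  obtain ys ps where ws: "ws = (ys, ps)"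
    by (cases ws)
  obtain Ks where "Ks > 0" and Ks: "\<And>u. u \<in> Lp_fun 2 \<mu> \<Longrightarrow> norm (S u) \<le> Ks * Lp_norm 2 \<mu> u"
    using S_bound by blast
  obtain Kj where "Kj > 0" and Kj: "\<And>v. Lp_norm r \<mu> (j v) \<le> Kj * norm v"
    using j_bound by blast
  define C where "C = (1 + onorm T) * Ks * Kj"
  have "C > 0"
    using \<open>Ks > 0\<close> \<open>Kj > 0\<close> onorm_pos_le[OF T] by (simp add: C_def add_pos_nonneg)
  have pos: "(\<epsilon> / C)\<^sup>2 > 0"
    using \<open>\<epsilon> > 0\<close> \<open>C > 0\<close> by simp
  obtain \<delta>0 where "\<delta>0 > 0" and \<delta>0: "\<And>d A N. d \<in> Lp_fun r \<mu> \<Longrightarrow> Lp_norm r \<mu> d \<le> N \<Longrightarrow> 0 < N \<Longrightarrow> N < \<delta>0 \<Longrightarrow>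
      AE x in \<mu>. A x \<in> clarke_jacobian h (j ps x + d x) \<Longrightarrow> A \<in> borel_measurable \<mu> \<Longrightarrow>
      (\<integral>x. (norm (h (j ps x + d x) - h (j ps x) - A x *v d x))\<^sup>2 \<partial>\<mu>) \<le> (\<epsilon> / C)\<^sup>2 * N\<^sup>2"
    by (rule superposition_semismooth[OF pa lip j_measurable[of ps] r pos]) (rule that)
  show ?thesis
  proof (intro exI[of _ "\<delta>0 / Kj"] conjI allI impI)
    show "\<delta>0 / Kj > 0"
      using \<open>\<delta>0 > 0\<close> \<open>Kj > 0\<close> by simp
    fix w \<delta>
    assume near: "norm (w - ws) < \<delta>0 / Kj" and step: "newton_step S T z h j M w \<delta>"
    obtain y p \<delta>y \<delta>p where w: "w = (y, p)" and \<delta>: "\<delta> = (\<delta>y, \<delta>p)"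
      by (cases w, cases \<delta>)
    define R where "R = (\<lambda>x. h (j p x) - h (j ps x) - M p x *v (j p x - j ps x))"
    have R: "R \<in> Lp_fun 2 \<mu>"
      unfolding R_def by (intro Lp_fun_2_diff superposition_L2 matrix_field_L2 j_L2)
    have err: "norm (w + \<delta> - ws) \<le> (1 + onorm T) * norm (S R)"
      using newton_step_error[of z ys ps y p \<delta>y \<delta>p] sol step by (simp add: w ws \<delta> R_def)
    define N where "N = Kj * norm (w - ws)"
    show "norm (w + \<delta> - ws) \<le> \<epsilon> * norm (w - ws)"
    proof (cases "w = ws")
      case True
      then have "R = (\<lambda>x. 0 *\<^sub>R R x)"
        by (auto simp: R_def w ws)
      then have "S R = 0"
        using S_scaleR[OF R, of 0] by simp
      with err True show ?thesis by simp
    next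
      case False
      define d where "d = (\<lambda>x. j p x - j ps x)"
      have dm: "d \<in> borel_measurable \<mu>"
        unfolding d_def by (intro borel_measurable_diff j_measurable)
      have ae: "AE x in \<mu>. j (p - ps) x = d x"
        using j_diff unfolding d_def .
      have "integrable \<mu> (\<lambda>x. norm (d x) powr r) \<longleftrightarrow> integrable \<mu> (\<lambda>x. norm (j (p - ps) x) powr r)"
      proof (rule integrable_cong_AE)
        show "AE x in \<mu>. norm (d x) powr r = norm (j (p - ps) x) powr r"
          using ae by eventually_elim simp
      qed (use dm j_measurable in measurable)
      then have d: "d \<in> Lp_fun r \<mu>"
        using j_Lr[of "p - ps"] dm by (simp add: Lp_fun_def)
      have "Lp_norm r \<mu> d = Lp_norm r \<mu> (j (p - ps))"
        by (rule Lp_norm_cong_AE[OF dm j_measurable]) (use ae in eventually_elim, simp)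
      also have "\<dots> \<le> Kj * norm (p - ps)"
        by (rule Kj)
      also have "\<dots> \<le> N"
        unfolding N_def w ws using norm_snd_le[of "p - ps" "y - ys"] \<open>Kj > 0\<close> by simp
      finally have dN: "Lp_norm r \<mu> d \<le> N" .
      have N: "0 < N" "N < \<delta>0"
        using False near \<open>Kj > 0\<close> by (simp_all add: N_def field_simps)
      have "(\<integral>x. (norm (h (j ps x + d x) - h (j ps x) - M p x *v d x))\<^sup>2 \<partial>\<mu>) \<le> (\<epsilon> / C)\<^sup>2 * N\<^sup>2"
        by (rule \<delta>0[OF d dN N _ M_measurable]) (use M_clarke[of p] in \<open>simp add: d_def\<close>)
      then have "(Lp_norm 2 \<mu> R)\<^sup>2 \<le> (\<epsilon> / C * N)\<^sup>2"
        unfolding Lp_norm_2_squared power_mult_distrib by (simp add: R_def d_def)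
      then have "Lp_norm 2 \<mu> R \<le> \<epsilon> / C * N"
        by (rule power2_le_imp_le) (use N \<open>\<epsilon> > 0\<close> \<open>C > 0\<close> in auto)
      then have "Ks * Lp_norm 2 \<mu> R \<le> Ks * (\<epsilon> / C * N)"
        using \<open>Ks > 0\<close> by (intro mult_left_mono) auto
      with Ks[OF R] have "norm (S R) \<le> Ks * (\<epsilon> / C * N)"
        by (rule order_trans)
      then have "(1 + onorm T) * norm (S R) \<le> (1 + onorm T) * (Ks * (\<epsilon> / C * N))"
        using onorm_pos_le[OF T] by (intro mult_left_mono) auto
      also have "\<dots> = C * (\<epsilon> / C * norm (w - ws))"
        by (simp add: C_def N_def)
      also have "\<dots> = \<epsilon> * norm (w - ws)"
        using \<open>C > 0\<close> by simp
      finally show ?thesis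
        using err by simp
    qed
  qed
qed

lemma newton_converges_superlinearly:
  assumes "solves_system S T z h j ws"
  shows "\<exists>N. open N \<and> ws \<in> N \<and>
    (\<forall>w0\<in>N. (\<exists>!w. newton_iterates S T z h j M w0 w) \<and>
      (\<forall>w. newton_iterates S T z h j M w0 w \<longrightarrow>
        w \<longlonglongrightarrow> ws \<and> (\<lambda>k. norm (w (Suc k) - ws)) \<in> o(\<lambda>k. norm (w k - ws))))"
  unfolding newton_iterates_def
  by (rule superlinear_convergence[OF newton_step_solvable newton_step_superlinear[OF assms]])

end

section \<open>Convergence for the switching control problem\<close>

theorem theorem5p3:
  fixes D :: "(real^'d) set"
    and S :: "(real^'d \<Rightarrow> real^2) \<Rightarrow> 'y::{real_inner,complete_space}"
    and T :: "'y \<Rightarrow> 'v::banach"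
    and j :: "'v \<Rightarrow> real^'d \<Rightarrow> real^2"
    and M :: "'v \<Rightarrow> real^'d \<Rightarrow> real^2^2"
    and z y\<^sub>\<gamma> :: 'y and p\<^sub>\<gamma> :: 'v
    and r \<alpha> \<beta> \<gamma> :: real
  assumes "D \<in> lmeasurable"
    and "\<alpha> > 0" and "\<beta> > 0" and "\<gamma> > 0"
    and "bounded_linear_L2 (lebesgue_on D) S"
    and "r > 2" and "Lp_embedding r (lebesgue_on D) j"
    and "bounded_linear T" and "is_adjoint_L2 (lebesgue_on D) S (\<lambda>y. j (T y))"
    and "newton_selection (lebesgue_on D) (h_reg \<alpha> \<beta> \<gamma>) j M"
    and "solves_system S T z (h_reg \<alpha> \<beta> \<gamma>) j (y\<^sub>\<gamma>, p\<^sub>\<gamma>)"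
  shows "\<exists>N. open N \<and> (y\<^sub>\<gamma>, p\<^sub>\<gamma>) \<in> N \<and>
    (\<forall>w0\<in>N.
      (\<exists>!w. newton_iterates S T z (h_reg \<alpha> \<beta> \<gamma>) j M w0 w) \<and>
      (\<forall>w. newton_iterates S T z (h_reg \<alpha> \<beta> \<gamma>) j M w0 w \<longrightarrow>
        w \<longlonglongrightarrow> (y\<^sub>\<gamma>, p\<^sub>\<gamma>) \<and>
        (\<lambda>k. norm (w (Suc k) - (y\<^sub>\<gamma>, p\<^sub>\<gamma>))) \<in> o(\<lambda>k. norm (w k - (y\<^sub>\<gamma>, p\<^sub>\<gamma>)))))"
proof -
  interpret finite_measure "lebesgue_on D"
    using assms(1) by (rule finite_measure_lebesgue_on)
  interpret semismooth_newton "lebesgue_on D" S T j "h_reg \<alpha> \<beta> \<gamma>"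
    "(\<lambda>\<phi> q. (1 / \<gamma>) *\<^sub>R (q - \<phi> q)) ` prox_pieces \<alpha> \<beta> \<gamma>" M r "1 / \<gamma>"
    using assms(5-10) piecewise_affine_h_reg[OF assms(2-4)] h_reg_lipschitz[OF assms(2-4)]
      h_reg_monotone[OF assms(2-4)]
    by (intro semismooth_newton.intro semismooth_newton_axioms.intro finite_measure_axioms)
  show ?thesis
    using assms(11) by (rule newton_converges_superlinearly)
qed

end
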